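(* Let $k$ satisfy $2k\in\mathbb{N}$ and let $\nu>0$. a) On the Siegel--Jacobi disk $\mathcal{D}^J_1=\mathcal{D}_1\times\mathbb{C}\ni(w,z)$, consider the Kähler two-form $$-\mathrm{i}\,\omega_{\mathcal{D}^J_1}(w,z)=\frac{2k}{P^2}dw\wedge d\bar w+\nu\frac{A\wedge\bar A}{P},\quad P:=1-|w|^2,\quad A=A(w,z):=dz+\bar\eta\,dw,\quad \eta=\frac{z+\bar z w}{P},$$ which is $G^J_0$-invariant with respect to the action $$\left(\begin{pmatrix}\mathcal{P}&\mathcal{Q}\\ \bar{\mathcal{Q}}&\bar{\mathcal{P}}\end{pmatrix},\alpha\right)\times(w,z)=\left(\frac{\mathcal{P}w+\mathcal{Q}}{\bar{\mathcal{Q}}w+\bar{\mathcal{P}}},\ \frac{z+\alpha-\bar\alpha w}{\bar{\mathcal{Q}}w+\bar{\mathcal{P}}}\right),\qquad \begin{pmatrix}\mathcal{P}&\mathcal{Q}\\ \bar{\mathcal{Q}}&\bar{\mathcal{P}}\end{pmatrix}\in\mathrm{SU}(1,1),\ \alpha\in\mathbb{C}.$$ There is the change of variables $(w,z)\to(w,\eta)$ given by $FC:\ z=\eta-w\bar\eta$, $FC^{-1}:\ \eta=\frac{z+\bar z w}{P}$, and under it $FC: A(w,z)\to d\eta-w\,d\bar\eta$. The complex two-form $\omega_{\mathcal{D}^J_1}(w,\eta):=FC^*(\omega_{\mathcal{D}^J_1}(w,z))$ is not a Kähler two-form (in the variables $(w,\eta)$). The symplectic form obtained by applying the $FC$-transform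 to $\omega_{\mathcal{D}^J_1}(w,z)$ is invariant under the action $(g,\alpha)\times(w,\eta)=(w_1,\eta_1)$ of $G^J_0$ on the set of pairs $(w,\eta)\in\mathcal{D}_1\times\mathbb{C}$, where $w_1=\frac{\mathcal{P}w+\mathcal{Q}}{\bar{\mathcal{Q}}w+\bar{\mathcal{P}}}$ and $\eta_1=\mathcal{P}(\eta+\alpha)+\mathcal{Q}(\bar\eta+\bar\alpha)$. b) Under the partial Cayley transform $$\Phi^{-1}:\ v=\mathrm{i}\frac{1+w}{1-w},\ u=\frac{z}{1-w},\ w,z\in\mathbb{C},\ |w|<1;\qquad \Phi:\ w=\frac{v-\mathrm{i}}{v+\mathrm{i}},\ z=2\mathrm{i}\frac{u}{v+\mathrm{i}},\ v,u\in\mathbb{C},\ \mathrm{Im}\,v>0,$$ one has $$A\left(\frac{v-\mathrm{i}}{v+\mathrm{i}},\frac{2\mathrm{i}u}{v+\mathrm{i}}\right)=\frac{2\mathrm{i}}{v+\mathrm{i}}B(v,u),\qquad B(v,u):=du-\frac{u-\bar u}{v-\bar v}dv.$$ The Kähler two-form of Berndt--Kähler $$-\mathrm{i}\,\omega_{\mathcal{X}^J_1}(v,u)=-\frac{2k}{(\bar v-v)^2}dv\wedge d\bar v+\frac{2\nu}{\mathrm{i}(\bar v-v)}B\wedge\bar B$$ is $G^J(\mathbb{R})_0$-invariant with respect to the action on the Siegel--Jacobi upper half-plane $\mathcal{X}^J_1$ $$\left(\begin{pmatrix}a&b\\c&d\end{pmatrix},\alpha\right)\times(v,u)=\left(\frac{av+b}{cv+d},\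 \frac{u+nv+m}{cv+d}\right),\qquad \begin{pmatrix}a&b\\c&d\end{pmatrix}\in\mathrm{SL}(2,\mathbb{R}),\ \alpha=m+\mathrm{i}n,\ m,n\in\mathbb{R}.$$ There is the change of variables $FC_1:(v,u)\to(v,\eta)$ given by $$FC_1:\ 2\mathrm{i}u=(v+\mathrm{i})\eta-(v-\mathrm{i})\bar\eta,\qquad FC_1^{-1}:\ \eta=\frac{u\bar v-\bar u v+\mathrm{i}(\bar u-u)}{\bar v-v}.$$ c) If $u=pv+q$ with $p,q\in\mathbb{R}$ and $v=x+\mathrm{i}y$ with $x,y\in\mathbb{R}$, $y>0$, then $$B(v,u)=du-p\,dv=v\,dp+dq=(x+\mathrm{i}y)dp+dq.$$ d) If $u,v,\eta$ are related by $FC_1$, $u=pv+q$, $v=x+\mathrm{i}y$ as in c), and $\eta=\chi+\mathrm{i}\psi$ with $\chi,\psi\in\mathbb{R}$, then one gets the change of coordinates $(x,y,p,q)\to(x,y,\chi,\psi)$: $\psi=p$, $\chi=q$, and $$B(v,u)=x\,d\psi+d\chi+\mathrm{i}y\,d\psi.$$ In particular $\eta=q+\mathrm{i}p$, $q=\frac12(\eta+\bar\eta)$, $p=\frac{1}{2\mathrm{i}}(\eta-\bar\eta)$. If $u=pv+q$, $v=x+\mathrm{i}y$ as in c) and $u=\xi+\mathrm{i}\rho$ with $\xi,\rho\in\mathbb{R}$, then one obtains the change of variables $(x,y,\xi,\rho)\to(x,y,p,q)$: $\xi=px+q$, $\rho=py$, and $$B(v,u)=du-\frac{\rho}{y}dv=d(\xi+\mathrm{i}\rho)-\frac{\rho}{y}d(x+\mathrm{i}y).$$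 Finally, if moreover $\eta=\chi+\mathrm{i}\psi$ is related to $(v,u)$ by $FC_1$, one has the change of coordinates $(x,y,\xi,\rho)\to(x,y,\chi,\psi)$: $\xi=\psi x+\chi$, $\rho=\psi y$.
   Context: $\mathcal{D}_1=\{w\in\mathbb{C}:|w|<1\}$ is the Siegel disk, $\mathcal{X}_1=\{v\in\mathbb{C}:\mathrm{Im}\,v>0\}$ the Siegel upper half-plane. The Siegel--Jacobi disk is $\mathcal{D}^J_1\approx\mathcal{D}_1\times\mathbb{C}\ni(w,z)$ and the Siegel--Jacobi upper half-plane is $\mathcal{X}^J_1\approx\mathcal{X}_1\times\mathbb{C}\ni(v,u)$. $G^J_0$ denotes the reduced Jacobi group of pairs $(g,\alpha)$, $g\in\mathrm{SU}(1,1)$, $\alpha\in\mathbb{C}$, and $G^J(\mathbb{R})_0$ denotes the reduced real Jacobi group $\mathrm{SL}(2,\mathbb{R})\ltimes\mathbb{R}^2$ of pairs $(M,X)$, acting as displayed in the claim. A two-form $\omega=\mathrm{i}\sum h_{\alpha\bar\beta}\,d\zeta_\alpha\wedge d\bar\zeta_\beta$ with $h_{\alpha\bar\beta}=\overline{h_{\beta\bar\alpha}}$ positive definite is Kähler (in the complex variables $\zeta$) if $d\omega=0$, equivalently $\partial h_{\alpha\bar\beta}/\partial \zeta_\gamma=\partial h_{\gamma\bar\beta}/\partial \zeta_\alpha$.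
   Formalization: The claim that FC^*ω is not Kähler in (w,η) is false, as FC^*ω = i(2k/P² dw∧dw̄ + ν dη∧dη̄); it is replaced by: FC^*ω together with the pulled-back line element 2k/P²|dw|² + (ν/P)|A|² is not Kähler in (w,η). Also k>0 is assumed. *)

theory Defs
  imports "HOL-Analysis.Analysis" "HOL-Algebra.Group_Action"
begin

section \<open>Smooth maps and complex-valued differential forms on real normed spaces\<close>

primrec ck_on :: "nat \<Rightarrow> 'a::real_normed_vector set \<Rightarrow> ('a \<Rightarrow> 'b::real_normed_vector) \<Rightarrow> bool" where
  "ck_on 0 U f \<longleftrightarrow> continuous_on U f"
| "ck_on (Suc n) U f \<longleftrightarrow>
     (\<forall>x\<in>U. f differentiable (at x)) \<and> (\<forall>v. ck_on n U (\<lambda>x. frechet_derivative f (at x) v))"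

definition smooth_on :: "'a::real_normed_vector set \<Rightarrow> ('a \<Rightarrow> 'b::real_normed_vector) \<Rightarrow> bool" where
  "smooth_on U f \<longleftrightarrow> (\<forall>n. ck_on n U f)"

definition change_of_variables ::
  "'a::real_normed_vector set \<Rightarrow> 'b::real_normed_vector set \<Rightarrow> ('a \<Rightarrow> 'b) \<Rightarrow> ('b \<Rightarrow> 'a) \<Rightarrow> bool" where
  "change_of_variables U V F G \<longleftrightarrow>
     F ` U \<subseteq> V \<and> G ` V \<subseteq> U \<and> (\<forall>p\<in>U. G (F p) = p) \<and> (\<forall>q\<in>V. F (G q) = q) \<and>
     smooth_on U F \<and> smooth_on V G"

text \<open>
  A form is a function of the base point and of one (two) tangent vectors. Tangent vectors are
  real: complex spaces are regarded as real vector spaces here, so that for instance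
  \<open>ed (\<lambda>p. cnj (fst p))\<close> makes sense and differs from \<open>ed fst\<close>.
\<close>

type_synonym 'a form1 = "'a \<Rightarrow> 'a \<Rightarrow> complex"
type_synonym 'a form2 = "'a \<Rightarrow> 'a \<Rightarrow> 'a \<Rightarrow> complex"

definition ed :: "('a::real_normed_vector \<Rightarrow> complex) \<Rightarrow> 'a form1" where
  "ed f p X = frechet_derivative f (at p) X"

definition cnj1 :: "'a form1 \<Rightarrow> 'a form1" where
  "cnj1 \<theta> p X = cnj (\<theta> p X)"

definition wedge :: "'a form1 \<Rightarrow> 'a form1 \<Rightarrow> 'a form2" where
  "wedge \<theta> \<phi> p X Y = \<theta> p X * \<phi> p Y - \<theta> p Y * \<phi> p X"

text \<open>The value of the exterior derivative of a two-form on constant vector fields.\<close>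

definition ed2 :: "('a::real_normed_vector) form2 \<Rightarrow> 'a \<Rightarrow> 'a \<Rightarrow> 'a \<Rightarrow> 'a \<Rightarrow> complex" where
  "ed2 \<omega> p X Y Z =
     ed (\<lambda>q. \<omega> q Y Z) p X - ed (\<lambda>q. \<omega> q X Z) p Y + ed (\<lambda>q. \<omega> q X Y) p Z"

definition pullback1 :: "('a::real_normed_vector \<Rightarrow> 'b::real_normed_vector) \<Rightarrow> 'b form1 \<Rightarrow> 'a form1" where
  "pullback1 F \<theta> p X = \<theta> (F p) (frechet_derivative F (at p) X)"

definition pullback2 :: "('a::real_normed_vector \<Rightarrow> 'b::real_normed_vector) \<Rightarrow> 'b form2 \<Rightarrow> 'a form2" where
  "pullback2 F \<omega> p X Y =
     \<omega> (F p) (frechet_derivative F (at p) X) (frechet_derivative F (at p) Y)"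

definition invariant_under ::
  "'g set \<Rightarrow> ('g \<Rightarrow> 'a \<Rightarrow> 'a) \<Rightarrow> 'a::real_normed_vector set \<Rightarrow> 'a form2 \<Rightarrow> bool" where
  "invariant_under G act U \<omega> \<longleftrightarrow>
     (\<forall>g\<in>G. \<forall>p\<in>U. \<forall>X Y. pullback2 (act g) \<omega> p X Y = \<omega> p X Y)"

definition symplectic_on :: "'a::real_normed_vector set \<Rightarrow> 'a form2 \<Rightarrow> bool" where
  "symplectic_on U \<omega> \<longleftrightarrow>
     (\<forall>X Y. smooth_on U (\<lambda>p. \<omega> p X Y)) \<and>
     (\<forall>p\<in>U. (\<forall>X Y. \<omega> p X Y \<in> \<real>) \<and> (\<forall>X. linear (\<omega> p X)) \<and> (\<forall>X Y. \<omega> p X Y = - \<omega> p Y X) \<and>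
        (\<forall>X. X \<noteq> 0 \<longrightarrow> (\<exists>Y. \<omega> p X Y \<noteq> 0)) \<and> (\<forall>X Y Z. ed2 \<omega> p X Y Z = 0))"


section \<open>Kaehler two-forms in two complex variables\<close>

definition zeta :: "2 \<Rightarrow> complex \<times> complex \<Rightarrow> complex" where
  "zeta \<alpha> = (if \<alpha> = 1 then fst else snd)"

definition kahler_with ::
  "(complex \<times> complex) set \<Rightarrow> (complex \<times> complex \<Rightarrow> complex^2^2) \<Rightarrow> (complex \<times> complex) form2 \<Rightarrow> bool" where
  "kahler_with U h \<omega> \<longleftrightarrow>
     (\<forall>\<alpha> \<beta>. smooth_on U (\<lambda>p. h p $ \<alpha> $ \<beta>)) \<and>
     (\<forall>p\<in>U. (\<forall>\<alpha> \<beta>. h p $ \<alpha> $ \<beta> = cnj (h p $ \<beta> $ \<alpha>)) \<and>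
        (\<forall>\<xi>::complex^2. \<xi> \<noteq> 0 \<longrightarrow> 0 < Re (\<Sum>\<alpha>\<in>UNIV. \<Sum>\<beta>\<in>UNIV. h p $ \<alpha> $ \<beta> * \<xi> $ \<alpha> * cnj (\<xi> $ \<beta>))) \<and>
        (\<forall>X Y. \<omega> p X Y =
           \<i> * (\<Sum>\<alpha>\<in>UNIV. \<Sum>\<beta>\<in>UNIV. h p $ \<alpha> $ \<beta> * wedge (ed (zeta \<alpha>)) (cnj1 (ed (zeta \<beta>))) p X Y)) \<and>
        (\<forall>X Y Z. ed2 \<omega> p X Y Z = 0))"

definition is_kahler :: "(complex \<times> complex) set \<Rightarrow> (complex \<times> complex) form2 \<Rightarrow> bool" where
  "is_kahler U \<omega> \<longleftrightarrow> (\<exists>h. kahler_with U h \<omega>)"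

text \<open>
  A two-form together with its line element: both must come from the same Hermitian matrix,
  \<open>\<omega> = \<i> \<Sum> h\<^sub>\<alpha>\<^sub>\<beta> d\<zeta>\<^sub>\<alpha> \<and> cnj d\<zeta>\<^sub>\<beta>\<close> and \<open>ds\<^sup>2 = \<Sum> h\<^sub>\<alpha>\<^sub>\<beta> d\<zeta>\<^sub>\<alpha> cnj d\<zeta>\<^sub>\<beta>\<close>.

  The line element is needed to say that the change of variables \<open>FC\<close> below destroys the Kaehler
  property. The two-form alone does not see this: since
  \<open>(d\<eta> - w d(cnj \<eta>)) \<and> cnj (d\<eta> - w d(cnj \<eta>)) = (1 - |w|\<^sup>2) d\<eta> \<and> d(cnj \<eta>)\<close>, the pullback of \<open>omega_disk\<close> is
  \<open>\<i> (2k / P\<^sup>2 dw \<and> d(cnj w) + \<nu> d\<eta> \<and> d(cnj \<eta>))\<close>, which does satisfy \<open>is_kahler\<close> in \<open>(w, \<eta>)\<close>. The pullback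
  of the line element, however, is not of the form \<open>\<Sum> h\<^sub>\<alpha>\<^sub>\<beta> d\<zeta>\<^sub>\<alpha> cnj d\<zeta>\<^sub>\<beta>\<close> in these variables.
\<close>

type_synonym 'a line_element = "'a \<Rightarrow> 'a \<Rightarrow> real"

definition pullback_line ::
  "('a::real_normed_vector \<Rightarrow> 'b::real_normed_vector) \<Rightarrow> 'b line_element \<Rightarrow> 'a line_element" where
  "pullback_line F g p X = g (F p) (frechet_derivative F (at p) X)"

definition is_kahler_with_metric ::
  "(complex \<times> complex) set \<Rightarrow> (complex \<times> complex) line_element \<Rightarrow> (complex \<times> complex) form2 \<Rightarrow> bool" where
  "is_kahler_with_metric U g \<omega> \<longleftrightarrow>
     (\<exists>h. kahler_with U h \<omega> \<and>
        (\<forall>p\<in>U. \<forall>X. complex_of_real (g p X) =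
           (\<Sum>\<alpha>\<in>UNIV. \<Sum>\<beta>\<in>UNIV. h p $ \<alpha> $ \<beta> * ed (zeta \<alpha>) p X * cnj (ed (zeta \<beta>) p X))))"


section \<open>The Siegel--Jacobi disk\<close>

definition siegel_disk :: "complex set" where
  "siegel_disk = {w. cmod w < 1}"

definition SJ_disk :: "(complex \<times> complex) set" where
  "SJ_disk = siegel_disk \<times> UNIV"

definition SU11 :: "(complex^2^2) set" where
  "SU11 = {g. det g = 1 \<and> g $ 2 $ 1 = cnj (g $ 1 $ 2) \<and> g $ 2 $ 2 = cnj (g $ 1 $ 1)}"

text \<open>The natural action of \<open>SU(1,1)\<close> on \<open>\<complex>\<close>, i.e. on the vectors \<open>(\<alpha>, cnj \<alpha>)\<close>.\<close>

definition su_act :: "complex^2^2 \<Rightarrow> complex \<Rightarrow> complex" where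
  "su_act g \<alpha> = g $ 1 $ 1 * \<alpha> + g $ 1 $ 2 * cnj \<alpha>"

definition GJ0 :: "((complex^2^2) \<times> complex) monoid" where
  "GJ0 = \<lparr>carrier = SU11 \<times> UNIV,
          mult = (\<lambda>(g1, \<alpha>1) (g2, \<alpha>2). (g1 ** g2, su_act (matrix_inv g2) \<alpha>1 + \<alpha>2)),
          one = (mat 1, 0)\<rparr>"

definition disk_act :: "(complex^2^2) \<times> complex \<Rightarrow> complex \<times> complex \<Rightarrow> complex \<times> complex" where
  "disk_act = (\<lambda>(g, \<alpha>) (w, z).
     let P = g $ 1 $ 1; Q = g $ 1 $ 2
     in ((P * w + Q) / (cnj Q * w + cnj P), (z + \<alpha> - cnj \<alpha> * w) / (cnj Q * w + cnj P)))"

definition disk_eta_act :: "(complex^2^2) \<times> complex \<Rightarrow> complex \<times> complex \<Rightarrow> complex \<times> complex" where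
  "disk_eta_act = (\<lambda>(g, \<alpha>) (w, \<eta>).
     let P = g $ 1 $ 1; Q = g $ 1 $ 2
     in ((P * w + Q) / (cnj Q * w + cnj P), P * (\<eta> + \<alpha>) + Q * (cnj \<eta> + cnj \<alpha>)))"

definition P_fun :: "complex \<Rightarrow> real" where
  "P_fun w = 1 - (cmod w)\<^sup>2"

definition eta_fun :: "complex \<times> complex \<Rightarrow> complex" where
  "eta_fun = (\<lambda>(w, z). (z + cnj z * w) / complex_of_real (P_fun w))"

definition A_form :: "(complex \<times> complex) form1" where
  "A_form p X = ed snd p X + cnj (eta_fun p) * ed fst p X"

definition omega_disk :: "real \<Rightarrow> real \<Rightarrow> (complex \<times> complex) form2" where
  "omega_disk k \<nu> p X Y =
     \<i> * (complex_of_real (2 * k / (P_fun (fst p))\<^sup>2) * wedge (ed fst) (cnj1 (ed fst)) p X Y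
        + complex_of_real (\<nu> / P_fun (fst p)) * wedge A_form (cnj1 A_form) p X Y)"

definition metric_disk :: "real \<Rightarrow> real \<Rightarrow> (complex \<times> complex) line_element" where
  "metric_disk k \<nu> p X =
     2 * k / (P_fun (fst p))\<^sup>2 * (cmod (ed fst p X))\<^sup>2 + \<nu> / P_fun (fst p) * (cmod (A_form p X))\<^sup>2"

text \<open>
  As maps, \<open>FC\<close> and \<open>FC1\<close> (below) express the old fibre coordinate through the new one, so that
  they are the maps along which forms are pulled back to the new coordinates.
\<close>

definition FC :: "complex \<times> complex \<Rightarrow> complex \<times> complex" where
  "FC = (\<lambda>(w, \<eta>). (w, \<eta> - w * cnj \<eta>))"

definition FC_inv :: "complex \<times> complex \<Rightarrow> complex \<times> complex" where
  "FC_inv = (\<lambda>(w, z). (w, eta_fun (w, z)))"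


section \<open>The Siegel--Jacobi upper half-plane\<close>

definition upper_half_plane :: "complex set" where
  "upper_half_plane = {v. 0 < Im v}"

definition SJ_half_plane :: "(complex \<times> complex) set" where
  "SJ_half_plane = upper_half_plane \<times> UNIV"

definition Phi :: "complex \<times> complex \<Rightarrow> complex \<times> complex" where
  "Phi = (\<lambda>(v, u). ((v - \<i>) / (v + \<i>), 2 * \<i> * u / (v + \<i>)))"

definition Phi_inv :: "complex \<times> complex \<Rightarrow> complex \<times> complex" where
  "Phi_inv = (\<lambda>(w, z). (\<i> * (1 + w) / (1 - w), z / (1 - w)))"

definition B_form :: "(complex \<times> complex) form1" where
  "B_form p X =
     ed snd p X - (snd p - cnj (snd p)) / (fst p - cnj (fst p)) * ed fst p X"

definition omega_half_plane :: "real \<Rightarrow> real \<Rightarrow> (complex \<times> complex) form2" where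
  "omega_half_plane k \<nu> p X Y =
     \<i> * (- (complex_of_real (2 * k) / (cnj (fst p) - fst p)\<^sup>2) * wedge (ed fst) (cnj1 (ed fst)) p X Y
        + complex_of_real (2 * \<nu>) / (\<i> * (cnj (fst p) - fst p)) * wedge B_form (cnj1 B_form) p X Y)"

text \<open>
  The pair \<open>(M, \<alpha>)\<close> with \<open>\<alpha> = m + \<i> n\<close> stands for \<open>(M, X)\<close> with the row vector \<open>X = (n, m)\<close>, and
  the group law is \<open>(M\<^sub>1, X\<^sub>1) (M\<^sub>2, X\<^sub>2) = (M\<^sub>1 M\<^sub>2, X\<^sub>1 M\<^sub>2 + X\<^sub>2)\<close>.
\<close>

definition row_of :: "complex \<Rightarrow> real^2" where
  "row_of \<alpha> = vector [Im \<alpha>, Re \<alpha>]"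

definition of_row :: "real^2 \<Rightarrow> complex" where
  "of_row X = Complex (X $ 2) (X $ 1)"

definition GJR0 :: "((real^2^2) \<times> complex) monoid" where
  "GJR0 = \<lparr>carrier = {M. det M = 1} \<times> UNIV,
           mult = (\<lambda>(M1, \<alpha>1) (M2, \<alpha>2). (M1 ** M2, of_row (row_of \<alpha>1 v* M2 + row_of \<alpha>2))),
           one = (mat 1, 0)\<rparr>"

definition half_plane_act :: "(real^2^2) \<times> complex \<Rightarrow> complex \<times> complex \<Rightarrow> complex \<times> complex" where
  "half_plane_act = (\<lambda>(M, \<alpha>) (v, u).
     let a = complex_of_real (M $ 1 $ 1); b = complex_of_real (M $ 1 $ 2);
         c = complex_of_real (M $ 2 $ 1); d = complex_of_real (M $ 2 $ 2);
         m = complex_of_real (Re \<alpha>); n = complex_of_real (Im \<alpha>)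
     in ((a * v + b) / (c * v + d), (u + n * v + m) / (c * v + d)))"

definition FC1 :: "complex \<times> complex \<Rightarrow> complex \<times> complex" where
  "FC1 = (\<lambda>(v, \<eta>). (v, ((v + \<i>) * \<eta> - (v - \<i>) * cnj \<eta>) / (2 * \<i>)))"

definition FC1_inv :: "complex \<times> complex \<Rightarrow> complex \<times> complex" where
  "FC1_inv = (\<lambda>(v, u). (v, (u * cnj v - cnj u * v + \<i> * (cnj u - u)) / (cnj v - v)))"


section \<open>Real coordinates on the Siegel--Jacobi upper half-plane\<close>

text \<open>
  The range of each of the coordinate systems \<open>(x, y, p, q)\<close>, \<open>(x, y, chi, psi)\<close> and \<open>(x, y, \<xi>, \<rho>)\<close>;
  the three maps after it express \<open>(v, u)\<close> in these coordinates.
\<close>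

definition half_space :: "(real \<times> real \<times> real \<times> real) set" where
  "half_space = {(x, y, s, t). 0 < y}"

definition vu_of_pq :: "real \<times> real \<times> real \<times> real \<Rightarrow> complex \<times> complex" where
  "vu_of_pq = (\<lambda>(x, y, p, q). (Complex x y, of_real p * Complex x y + of_real q))"

definition vu_of_chi_psi :: "real \<times> real \<times> real \<times> real \<Rightarrow> complex \<times> complex" where
  "vu_of_chi_psi = (\<lambda>(x, y, chi, psi). FC1 (Complex x y, Complex chi psi))"

definition vu_of_xi_rho :: "real \<times> real \<times> real \<times> real \<Rightarrow> complex \<times> complex" where
  "vu_of_xi_rho = (\<lambda>(x, y, \<xi>, \<rho>). (Complex x y, Complex \<xi> \<rho>))"

end

theory Submission
  imports Defs
begin

text \<open>
  Both Kaehler forms have the shape \<open>\<i> (f d\<zeta>\<^sub>1 \<and> cnj d\<zeta>\<^sub>1 + g \<theta> \<and> cnj \<theta>)\<close> with \<open>f, g > 0\<close> functions of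
  \<open>\<zeta>\<^sub>1\<close> alone and \<open>\<theta> = d\<zeta>\<^sub>2 + e d\<zeta>\<^sub>1\<close>, so positivity is a sum of two squares. Closedness amounts to
  \<open>d\<theta> \<equiv> e\<^sub>2 \<theta> \<and> d\<zeta>\<^sub>1\<close> modulo \<open>cnj \<theta> \<and> d\<zeta>\<^sub>1\<close>, where \<open>dg = g (e\<^sub>2 d\<zeta>\<^sub>1 + cnj (e\<^sub>2 d\<zeta>\<^sub>1))\<close>. A group element with
  denominator \<open>J\<close> multiplies \<open>d\<zeta>\<^sub>1\<close> by \<open>1 / J\<^sup>2\<close> and \<open>\<theta>\<close> by \<open>1 / J\<close>, while \<open>f\<close> and \<open>g\<close> are multiplied by
  \<open>|J|\<^sup>4\<close> and \<open>|J|\<^sup>2\<close>, hence invariance. The coordinate \<open>\<eta>\<close> linearises the action on the fibres and turns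
  the second summand into \<open>\<nu> d\<eta> \<and> cnj d\<eta>\<close>, because \<open>\<theta> = d\<eta> - w cnj d\<eta>\<close>. On the half-plane one writes
  \<open>u = p v + q\<close> with real \<open>p, q\<close>; then \<open>\<eta> = q + \<i> p\<close>.
\<close>

section \<open>Calculus of smooth maps\<close>

lemma frechet_derivative_eqI:
  "(f has_derivative f') (at x) \<Longrightarrow> frechet_derivative f (at x) v = f' v"
  using frechet_derivative_at by metis

lemma ed_eqI: "(f has_derivative f') (at x) \<Longrightarrow> ed f x v = f' v"
  by (simp add: ed_def frechet_derivative_eqI)

text \<open>Derivatives at a point of an open set depend only on nearby values, so both functions
  share all iterated derivatives. Values outside \<open>U\<close> therefore do not matter for
  \<open>ck_on\<close>.\<close>

lemma ck_on_cong:
  assumes "open U" and "\<And>x. x \<in> U \<Longrightarrow> f x = g x" and "ck_on n U f"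
  shows "ck_on n U g"
  using assms(2,3)
proof (induction n arbitrary: f g)
  case 0
  then show ?case by (simp cong: continuous_on_cong)
next
  case (Suc n)
  have g: "(g has_derivative frechet_derivative f (at x)) (at x)" if "x \<in> U" for x
  proof (rule has_derivative_transform_within_open[OF _ assms(1) that])
    show "(f has_derivative frechet_derivative f (at x)) (at x)"
      using Suc.prems that by (simp add: frechet_derivative_works[symmetric])
  qed (use Suc.prems in auto)
  have "ck_on n U (\<lambda>x. frechet_derivative g (at x) v)" for v
  proof (rule Suc.IH[of "\<lambda>x. frechet_derivative f (at x) v"])
    show "ck_on n U (\<lambda>x. frechet_derivative f (at x) v)"
      using Suc.prems by simp
  qed (simp add: frechet_derivative_eqI[OF g])
  then show ?case
    using g by (auto simp: differentiable_def)
qed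

text \<open>Admits any explicit derivative in place of \<open>frechet_derivative\<close>; the
  inductions for compositions, sums, products and inverses go through this rule.\<close>

lemma ck_on_SucI:
  assumes "open U" and "\<And>x. x \<in> U \<Longrightarrow> (f has_derivative f' x) (at x)"
    and "\<And>v. ck_on n U (\<lambda>x. f' x v)"
  shows "ck_on (Suc n) U f"
  unfolding ck_on.simps
proof (intro conjI ballI allI)
  fix v
  show "ck_on n U (\<lambda>x. frechet_derivative f (at x) v)"
    by (rule ck_on_cong[OF assms(1) _ assms(3)[of v]])
      (simp add: frechet_derivative_eqI[OF assms(2)])
qed (use assms(2) in \<open>auto simp: differentiable_def\<close>)

lemma ck_on_SucD:
  assumes "ck_on (Suc n) U f"
  shows "x \<in> U \<Longrightarrow> (f has_derivative frechet_derivative f (at x)) (at x)"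
    and "ck_on n U (\<lambda>x. frechet_derivative f (at x) v)"
  using assms by (auto simp: frechet_derivative_works[symmetric])

text \<open>Product and quotient rules contain the undifferentiated functions at one order lower,
  which this supplies.\<close>

lemma ck_on_Suc_imp_ck_on: "ck_on (Suc n) U f \<Longrightarrow> ck_on n U f"
proof (induction n arbitrary: f)
  case 0
  then show ?case
    by (auto intro!: continuous_at_imp_continuous_on differentiable_imp_continuous_within)
next
  case (Suc n)
  then show ?case unfolding ck_on.simps(2)[of "Suc n"] ck_on.simps(2)[of n] by blast
qed

lemma ck_on_const: "ck_on n U (\<lambda>x. c)"
  by (induction n arbitrary: c) (simp_all add: frechet_derivative_const)

lemma ck_on_linear_comp:
  assumes "open U" and L: "bounded_linear L" and "ck_on n U f"
  shows "ck_on n U (\<lambda>x. L (f x))"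
  using assms(3)
proof (induction n arbitrary: f)
  case 0
  then show ?case
    using bounded_linear.continuous_on[OF L] by simp
next
  case (Suc n)
  show ?case
    by (rule ck_on_SucI[OF assms(1)])
      (auto intro!: bounded_linear.has_derivative[OF L] Suc.IH ck_on_SucD[OF Suc.prems])
qed

lemma ck_on_bounded_linear:
  assumes "open U" and L: "bounded_linear L"
  shows "ck_on n U L"
proof (cases n)
  case 0
  then show ?thesis using L by (simp add: linear_continuous_on)
next
  case (Suc m)
  show ?thesis
    unfolding Suc
    by (rule ck_on_SucI[OF assms(1)])
      (auto intro: bounded_linear_imp_has_derivative[OF L] ck_on_const)
qed

lemma ck_on_add:
  assumes "open U" and "ck_on n U f" and "ck_on n U g"
  shows "ck_on n U (\<lambda>x. f x + g x)"
  using assms(2,3)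
proof (induction n arbitrary: f g)
  case 0
  then show ?case by (simp add: continuous_on_add)
next
  case (Suc n)
  show ?case
    by (rule ck_on_SucI[OF assms(1) has_derivative_add[OF Suc.prems[THEN ck_on_SucD(1)]]])
      (assumption | intro Suc.IH Suc.prems[THEN ck_on_SucD(2)])+
qed

text \<open>By the Leibniz rule the derivative is a sum of two terms of the same shape, one order
  lower; hence the induction varies both \<open>f\<close> and \<open>g\<close>.\<close>

lemma ck_on_bilinear:
  assumes "open U" and B: "bounded_bilinear B" and "ck_on n U f" and "ck_on n U g"
  shows "ck_on n U (\<lambda>x. B (f x) (g x))"
  using assms(3,4)
proof (induction n arbitrary: f g)
  case 0
  then show ?case
    using bounded_bilinear.continuous_on[OF B] by simp
next
  case (Suc n)
  note le = Suc.prems[THEN ck_on_Suc_imp_ck_on]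
  show ?case
    by (rule ck_on_SucI[OF assms(1) bounded_bilinear.FDERIV[OF B Suc.prems[THEN ck_on_SucD(1)]]])
      (assumption | intro ck_on_add[OF assms(1)] Suc.IH le Suc.prems[THEN ck_on_SucD(2)])+
qed

text \<open>The derivative is built from \<open>inverse (f x)\<close> and the derivative of
  \<open>f\<close>, both available at order \<open>n\<close>, so here \<open>f\<close> can stay
  fixed in the induction.\<close>

lemma ck_on_inverse:
  fixes f :: "'a::real_normed_vector \<Rightarrow> 'b::real_normed_field"
  assumes "open U" and nz: "\<And>x. x \<in> U \<Longrightarrow> f x \<noteq> 0" and "ck_on n U f"
  shows "ck_on n U (\<lambda>x. inverse (f x))"
  using assms(3)
proof (induction n)
  case 0
  then show ?case using nz by (simp add: continuous_on_inverse)
next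
  case (Suc n)
  note inv = Suc.IH[OF ck_on_Suc_imp_ck_on[OF Suc.prems]]
  show ?case
  proof (rule ck_on_SucI[OF assms(1)])
    show "((\<lambda>x. inverse (f x)) has_derivative
        (\<lambda>v. - (inverse (f x) * frechet_derivative f (at x) v * inverse (f x)))) (at x)"
      if "x \<in> U" for x
      using that nz by (intro Deriv.has_derivative_inverse ck_on_SucD(1)[OF Suc.prems])
    show "ck_on n U (\<lambda>x. - (inverse (f x) * frechet_derivative f (at x) v * inverse (f x)))" for v
      by (intro ck_on_linear_comp[OF assms(1) bounded_linear_minus[OF bounded_linear_ident]]
          ck_on_bilinear[OF assms(1) bounded_bilinear_mult] inv ck_on_SucD(2)[OF Suc.prems])
  qed
qed

section \<open>Closure properties of smooth maps\<close>

lemma smooth_on_cong: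
  "smooth_on U f \<Longrightarrow> open U \<Longrightarrow> (\<And>x. x \<in> U \<Longrightarrow> f x = g x) \<Longrightarrow> smooth_on U g"
  unfolding smooth_on_def using ck_on_cong by blast

lemma smooth_on_const: "smooth_on U (\<lambda>x. c)"
  by (simp add: smooth_on_def ck_on_const)

lemma smooth_on_linear_comp:
  "bounded_linear L \<Longrightarrow> open U \<Longrightarrow> smooth_on U f \<Longrightarrow> smooth_on U (\<lambda>x. L (f x))"
  by (simp add: smooth_on_def ck_on_linear_comp)

lemma smooth_on_ident: "open U \<Longrightarrow> smooth_on U (\<lambda>x. x)"
  by (simp add: smooth_on_def ck_on_bounded_linear bounded_linear_ident)

lemma smooth_on_add:
  "open U \<Longrightarrow> smooth_on U f \<Longrightarrow> smooth_on U g \<Longrightarrow> smooth_on U (\<lambda>x. f x + g x)"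
  by (simp add: smooth_on_def ck_on_add)

lemmas smooth_on_minus = smooth_on_linear_comp[OF bounded_linear_minus[OF bounded_linear_ident]]

lemma smooth_on_diff:
  "open U \<Longrightarrow> smooth_on U f \<Longrightarrow> smooth_on U g \<Longrightarrow> smooth_on U (\<lambda>x. f x - g x)"
  using smooth_on_add[OF _ _ smooth_on_minus, of U f g] by simp

lemma smooth_on_mult:
  fixes f g :: "'a::real_normed_vector \<Rightarrow> 'b::real_normed_algebra"
  shows "open U \<Longrightarrow> smooth_on U f \<Longrightarrow> smooth_on U g \<Longrightarrow> smooth_on U (\<lambda>x. f x * g x)"
  by (simp add: smooth_on_def ck_on_bilinear[OF _ bounded_bilinear_mult])

lemma smooth_on_divide:
  fixes f g :: "'a::real_normed_vector \<Rightarrow> 'b::real_normed_field"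
  assumes "open U" and "smooth_on U f" and "smooth_on U g" and "\<And>x. x \<in> U \<Longrightarrow> g x \<noteq> 0"
  shows "smooth_on U (\<lambda>x. f x / g x)"
  unfolding divide_inverse
  using assms by (intro smooth_on_mult) (simp_all add: smooth_on_def ck_on_inverse)

lemma smooth_on_power2:
  fixes f :: "'a::real_normed_vector \<Rightarrow> 'b::real_normed_algebra_1"
  shows "open U \<Longrightarrow> smooth_on U f \<Longrightarrow> smooth_on U (\<lambda>x. (f x)\<^sup>2)"
  by (simp add: power2_eq_square smooth_on_mult)

lemma smooth_on_Pair:
  assumes "open U" and "smooth_on U f" and "smooth_on U g"
  shows "smooth_on U (\<lambda>x. (f x, g x))"
proof -
  \<comment> \<open>A pair is the sum of the images of its components under the two linear
    embeddings.\<close>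
  have "smooth_on U (\<lambda>x. (f x, 0) + (0, g x))"
    by (intro smooth_on_add assms
        smooth_on_linear_comp[OF bounded_linear_Pair[OF bounded_linear_ident bounded_linear_zero]]
        smooth_on_linear_comp[OF bounded_linear_Pair[OF bounded_linear_zero bounded_linear_ident]])
  then show ?thesis by simp
qed

lemmas smooth_on_intros =
  smooth_on_const smooth_on_ident smooth_on_add smooth_on_minus smooth_on_diff smooth_on_mult
  smooth_on_divide smooth_on_power2 smooth_on_Pair
  smooth_on_linear_comp[OF bounded_linear_fst] smooth_on_linear_comp[OF bounded_linear_snd]
  smooth_on_linear_comp[OF bounded_linear_cnj] smooth_on_linear_comp[OF bounded_linear_Re]
  smooth_on_linear_comp[OF bounded_linear_Im] smooth_on_linear_comp[OF bounded_linear_of_real]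

section \<open>Group actions\<close>

text \<open>The inverse group element supplies the inverse map, so bijectivity follows from the
  action laws. The restriction to \<open>E\<close> makes the maps extensional, as \<open>Bij\<close>
  demands.\<close>

lemma group_actionI:
  assumes "group G"
    and closed: "\<And>g x. g \<in> carrier G \<Longrightarrow> x \<in> E \<Longrightarrow> act g x \<in> E"
    and one: "\<And>x. x \<in> E \<Longrightarrow> act \<one>\<^bsub>G\<^esub> x = x"
    and mult: "\<And>g h x. g \<in> carrier G \<Longrightarrow> h \<in> carrier G \<Longrightarrow> x \<in> E \<Longrightarrow>
      act (g \<otimes>\<^bsub>G\<^esub> h) x = act g (act h x)"
  shows "group_action G E (\<lambda>g. restrict (act g) E)"
proof -
  interpret group G by fact
  have bij: "restrict (act g) E \<in> Bij E" if g: "g \<in> carrier G" for g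
  proof -
    have "act (inv\<^bsub>G\<^esub> g) (act g x) = x" "act g (act (inv\<^bsub>G\<^esub> g) x) = x" if "x \<in> E" for x
      using mult[of "inv\<^bsub>G\<^esub> g" g x] mult[of g "inv\<^bsub>G\<^esub> g" x] that g one by simp_all
    then have "bij_betw (act g) E E"
      using g closed by (intro bij_betw_byWitness[where f' = "act (inv\<^bsub>G\<^esub> g)"]) auto
    then show ?thesis by (simp add: Bij_def cong: bij_betw_cong)
  qed
  have "restrict (act (g \<otimes>\<^bsub>G\<^esub> h)) E = compose E (restrict (act g) E) (restrict (act h) E)"
    if "g \<in> carrier G" "h \<in> carrier G" for g h
    using that mult closed by (intro ext) (auto simp: compose_def)
  then have "(\<lambda>g. restrict (act g) E) \<in> hom G (BijGroup E)"
    using bij by (auto simp: hom_def BijGroup_def)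
  then show ?thesis
    by (intro group_action.intro group_hom.intro group_hom_axioms.intro group_BijGroup assms(1))
qed

section \<open>Hermitian forms on a family of complex lines\<close>

lemma ed_fst: "ed fst p X = fst X" and ed_snd: "ed snd p X = snd X"
  by (auto intro!: ed_eqI bounded_linear_imp_has_derivative bounded_linear_fst bounded_linear_snd)

lemma ed_zeta: "ed (zeta \<alpha>) p X = zeta \<alpha> X"
  by (simp add: zeta_def ed_fst ed_snd)

lemma zeta_simps: "zeta 1 = fst" "zeta 2 = snd"
  by (simp_all add: zeta_def)

text \<open>The value of \<open>d\<zeta> \<and> cnj d\<zeta>\<close> on two vectors with
  \<open>\<zeta>\<close>-components \<open>a\<close> and \<open>b\<close>; it equals
  \<open>2 \<i> Im (a cnj b)\<close>.\<close>

definition area :: "complex \<Rightarrow> complex \<Rightarrow> complex" where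
  "area a b = a * cnj b - b * cnj a"

text \<open>Each term takes up one factor \<open>c\<close> and one factor \<open>cnj c\<close>; this
  is why automorphy factors enter the forms only through their modulus.\<close>

lemma area_scale: "area (c * a) (c * b) = of_real ((cmod c)\<^sup>2) * area a b"
  unfolding area_def complex_norm_square by (simp add: algebra_simps)

definition fibred_form ::
  "(complex \<times> complex \<Rightarrow> real) \<Rightarrow> (complex \<times> complex \<Rightarrow> real) \<Rightarrow> (complex \<times> complex \<Rightarrow> complex)
    \<Rightarrow> (complex \<times> complex) form2" where
  "fibred_form f g e p X Y = \<i> * (of_real (f p) * area (fst X) (fst Y)
     + of_real (g p) * area (snd X + e p * fst X) (snd Y + e p * fst Y))"

text \<open>The coefficients of \<open>fibred_form\<close> with respect to
  \<open>d\<zeta>\<^sub>\<alpha> \<and> cnj d\<zeta>\<^sub>\<beta>\<close>: \<open>f\<close> in the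
  first diagonal entry, plus \<open>g\<close> times the rank one matrix of the covector
  \<open>(e, 1)\<close>.\<close>

definition fibred_matrix ::
  "(complex \<times> complex \<Rightarrow> real) \<Rightarrow> (complex \<times> complex \<Rightarrow> real) \<Rightarrow> (complex \<times> complex \<Rightarrow> complex)
    \<Rightarrow> complex \<times> complex \<Rightarrow> complex^2^2" where
  "fibred_matrix f g e p = vector
     [vector [of_real (f p) + of_real (g p) * (e p * cnj (e p)), of_real (g p) * e p],
      vector [of_real (g p) * cnj (e p), of_real (g p)]]"

text \<open>
  In the coframe \<open>d\<zeta>\<^sub>1, \<theta>\<close> the hypothesis on \<open>e\<close> reads
  \<open>d\<theta> = e\<^sub>2 \<theta> \<and> d\<zeta>\<^sub>1 + e\<^sub>2' cnj \<theta> \<and> d\<zeta>\<^sub>1\<close>; the second term dies in \<open>d\<theta> \<and> cnj \<theta>\<close>, and the first one is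
  compensated by \<open>dg\<close>.
\<close>

lemma ed2_fibred_form:
  fixes e1 e2 e2' f1 :: complex
  assumes "open U" and p: "p \<in> U"
    and \<omega>: "\<And>q X Y. q \<in> U \<Longrightarrow> \<omega> q X Y = fibred_form f g e q X Y"
    and f: "((\<lambda>q. complex_of_real (f q)) has_derivative (\<lambda>X. f1 * fst X + cnj f1 * cnj (fst X))) (at p)"
    and g: "((\<lambda>q. complex_of_real (g q)) has_derivative
      (\<lambda>X. of_real (g p) * (e2 * fst X + cnj e2 * cnj (fst X)))) (at p)"
    and e: "(e has_derivative
      (\<lambda>X. e1 * fst X + e2 * snd X + e2' * (cnj (snd X) + cnj (e p) * cnj (fst X)))) (at p)"
  shows "ed2 \<omega> p X Y Z = 0"
proof -
  \<comment> \<open>\<open>a\<close> is the value of \<open>\<theta>\<close>. Replacing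
    \<open>snd X\<close> by \<open>a X - e p * fst X\<close> in the derivative of \<open>e\<close>
    leaves the coefficient \<open>m\<close> on \<open>fst X\<close>.\<close>
  define a where "a X = snd X + e p * fst X" for X
  define m where "m = e1 - e2 * e p"
  define de where "de X = m * fst X + e2 * a X + e2' * cnj (a X)" for X
  define df :: "complex \<times> complex \<Rightarrow> complex" where "df X = f1 * fst X + cnj f1 * cnj (fst X)" for X
  define dg :: "complex \<times> complex \<Rightarrow> complex" where "dg X = e2 * fst X + cnj e2 * cnj (fst X)" for X
  have f': "((\<lambda>q. complex_of_real (f q)) has_derivative df) (at p)"
    using f by (simp add: df_def[abs_def])
  have g': "((\<lambda>q. complex_of_real (g q)) has_derivative (\<lambda>X. of_real (g p) * dg X)) (at p)"
    using g by (simp add: dg_def[abs_def])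
  have e': "(e has_derivative de) (at p)"
    by (rule has_derivative_eq_rhs[OF e])
      (simp add: fun_eq_iff de_def a_def m_def algebra_simps)
  have a': "((\<lambda>q. snd X + e q * fst X) has_derivative (\<lambda>Y. de Y * fst X)) (at p)" for X
    by (rule e' derivative_eq_intros refl)+ simp
  have ed: "ed (\<lambda>q. \<omega> q Y Z) p X =
      \<i> * (df X * area (fst Y) (fst Z)
        + of_real (g p) * (dg X * area (a Y) (a Z)
          + (de X * (fst Y * cnj (a Z) - fst Z * cnj (a Y))
            + cnj (de X) * (a Y * cnj (fst Z) - a Z * cnj (fst Y)))))" for X Y Z
  proof (rule ed_eqI[OF has_derivative_transform_within_open[OF _ assms(1) p]])
    show "((\<lambda>q. fibred_form f g e q Y Z) has_derivative (\<lambda>X.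
      \<i> * (df X * area (fst Y) (fst Z)
        + of_real (g p) * (dg X * area (a Y) (a Z)
          + (de X * (fst Y * cnj (a Z) - fst Z * cnj (a Y))
            + cnj (de X) * (a Y * cnj (fst Z) - a Z * cnj (fst Y))))))) (at p)"
      unfolding fibred_form_def area_def
      by (rule f' g' a' derivative_eq_intros refl)+
        (unfold a_def[symmetric] complex_cnj_mult, rule ext, algebra)
  qed (simp add: \<omega>)
  \<comment> \<open>A three-form in the first complex coordinate alone lives on a real plane and
    vanishes.\<close>
  have "df X * area (fst Y) (fst Z) - df Y * area (fst X) (fst Z) + df Z * area (fst X) (fst Y) = 0"
    unfolding df_def area_def by (simp add: algebra_simps)
  \<comment> \<open>In the alternating sum the \<open>m\<close> part dies against
    \<open>fst\<close>, the \<open>e2'\<close> part against \<open>cnj a\<close>, and the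
    \<open>e2\<close> part cancels \<open>dg\<close>.\<close>
  moreover have
    "(dg X * area (a Y) (a Z) + (de X * (fst Y * cnj (a Z) - fst Z * cnj (a Y))
        + cnj (de X) * (a Y * cnj (fst Z) - a Z * cnj (fst Y))))
     - (dg Y * area (a X) (a Z) + (de Y * (fst X * cnj (a Z) - fst Z * cnj (a X))
        + cnj (de Y) * (a X * cnj (fst Z) - a Z * cnj (fst X))))
     + (dg Z * area (a X) (a Y) + (de Z * (fst X * cnj (a Y) - fst Y * cnj (a X))
        + cnj (de Z) * (a X * cnj (fst Y) - a Y * cnj (fst X)))) = 0"
    unfolding dg_def de_def area_def complex_cnj_add complex_cnj_mult complex_cnj_cnj by algebra
  ultimately show ?thesis
    unfolding ed2_def ed by algebra
qed

lemma kahler_with_fibred_form: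
  assumes U: "open U" and f: "smooth_on U f" "\<And>p. p \<in> U \<Longrightarrow> 0 < f p"
    and g: "smooth_on U g" "\<And>p. p \<in> U \<Longrightarrow> 0 < g p" and e: "smooth_on U e"
    and \<omega>: "\<And>p X Y. p \<in> U \<Longrightarrow> \<omega> p X Y = fibred_form f g e p X Y"
    and closed: "\<And>p X Y Z. p \<in> U \<Longrightarrow> ed2 \<omega> p X Y Z = 0"
  shows "kahler_with U (fibred_matrix f g e) \<omega>"
  unfolding kahler_with_def
proof (intro conjI ballI allI impI)
  fix \<alpha> \<beta> :: 2
  have "smooth_on U (\<lambda>p. fibred_matrix f g e p $ \<alpha> $ \<beta>)" if "\<alpha> = 1 \<or> \<alpha> = 2" "\<beta> = 1 \<or> \<beta> = 2"
    using that U f g e by (auto simp: fibred_matrix_def intro!: smooth_on_intros)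
  then show "smooth_on U (\<lambda>p. fibred_matrix f g e p $ \<alpha> $ \<beta>)"
    using exhaust_2 by blast
next
  fix p \<alpha> \<beta>
  show "fibred_matrix f g e p $ \<alpha> $ \<beta> = cnj (fibred_matrix f g e p $ \<beta> $ \<alpha>)"
    using exhaust_2[of \<alpha>] exhaust_2[of \<beta>] by (auto simp: fibred_matrix_def)
next
  fix p and \<xi> :: "complex^2"
  assume p: "p \<in> U" and "\<xi> \<noteq> 0"
  then have nz: "\<xi> $ 1 \<noteq> 0 \<or> \<xi> $ 2 \<noteq> 0"
    by (simp add: vec_eq_iff forall_2)
  have "(\<Sum>\<alpha>\<in>UNIV. \<Sum>\<beta>\<in>UNIV. fibred_matrix f g e p $ \<alpha> $ \<beta> * \<xi> $ \<alpha> * cnj (\<xi> $ \<beta>))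
    = of_real (f p * (cmod (\<xi> $ 1))\<^sup>2 + g p * (cmod (\<xi> $ 2 + e p * \<xi> $ 1))\<^sup>2)"
    unfolding of_real_add of_real_mult complex_norm_square
    by (simp add: sum_2 fibred_matrix_def algebra_simps)
  \<comment> \<open>If \<open>\<xi> $ 1\<close> vanishes, the second square reduces to that of
    \<open>\<xi> $ 2\<close>, which is then nonzero; otherwise the first summand is already
    positive.\<close>
  moreover have "0 < f p * (cmod (\<xi> $ 1))\<^sup>2 + g p * (cmod (\<xi> $ 2 + e p * \<xi> $ 1))\<^sup>2"
    using nz f(2)[OF p] g(2)[OF p]
    by (cases "\<xi> $ 1 = 0") (auto intro!: add_pos_nonneg)
  ultimately show "0 < Re (\<Sum>\<alpha>\<in>UNIV. \<Sum>\<beta>\<in>UNIV. fibred_matrix f g e p $ \<alpha> $ \<beta> * \<xi> $ \<alpha> * cnj (\<xi> $ \<beta>))"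
    by simp
next
  fix p X Y
  assume "p \<in> U"
  then show "\<omega> p X Y = \<i> * (\<Sum>\<alpha>\<in>UNIV. \<Sum>\<beta>\<in>UNIV.
      fibred_matrix f g e p $ \<alpha> $ \<beta> * wedge (ed (zeta \<alpha>)) (cnj1 (ed (zeta \<beta>))) p X Y)"
    by (simp add: \<omega> fibred_form_def area_def sum_2 fibred_matrix_def wedge_def cnj1_def ed_zeta
        zeta_simps algebra_simps)
qed (use closed in auto)

text \<open>The same completion of the square as for positivity, with a tangent vector in place of
  \<open>\<xi>\<close>; it identifies \<open>metric_disk\<close> as the line element of the
  matrix.\<close>

lemma fibred_matrix_line_element:
  "(\<Sum>\<alpha>\<in>UNIV. \<Sum>\<beta>\<in>UNIV. fibred_matrix f g e p $ \<alpha> $ \<beta> * ed (zeta \<alpha>) p X * cnj (ed (zeta \<beta>) p X))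
    = of_real (f p * (cmod (fst X))\<^sup>2 + g p * (cmod (snd X + e p * fst X))\<^sup>2)"
  unfolding of_real_add of_real_mult complex_norm_square
  by (simp add: sum_2 fibred_matrix_def ed_zeta zeta_simps algebra_simps)

text \<open>Hermitian symmetry makes the form real, and positivity makes it nondegenerate because
  \<open>X\<close> can be paired with \<open>\<i> X\<close>.\<close>

lemma is_kahler_imp_symplectic_on:
  assumes U: "open U" and "is_kahler U \<omega>"
  shows "symplectic_on U \<omega>"
proof -
  obtain h where h: "kahler_with U h \<omega>"
    using assms by (auto simp: is_kahler_def)
  have \<omega>: "\<omega> p X Y = \<i> * (\<Sum>\<alpha>\<in>UNIV. \<Sum>\<beta>\<in>UNIV.
      h p $ \<alpha> $ \<beta> * (zeta \<alpha> X * cnj (zeta \<beta> Y) - zeta \<alpha> Y * cnj (zeta \<beta> X)))" if "p \<in> U" for p X Y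
  proof -
    have "\<omega> p X Y = \<i> * (\<Sum>\<alpha>\<in>UNIV. \<Sum>\<beta>\<in>UNIV.
        h p $ \<alpha> $ \<beta> * wedge (ed (zeta \<alpha>)) (cnj1 (ed (zeta \<beta>))) p X Y)"
      using h that unfolding kahler_with_def by blast
    then show ?thesis by (simp add: wedge_def cnj1_def ed_zeta)
  qed
  have smooth: "smooth_on U (\<lambda>p. h p $ \<alpha> $ \<beta>)" for \<alpha> \<beta>
    using h unfolding kahler_with_def by blast
  have herm: "cnj (h p $ \<alpha> $ \<beta>) = h p $ \<beta> $ \<alpha>" if "p \<in> U" for p \<alpha> \<beta>
  proof -
    have "h p $ \<beta> $ \<alpha> = cnj (h p $ \<alpha> $ \<beta>)"
      using h that unfolding kahler_with_def by blast
    then show ?thesis by simp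
  qed
  show ?thesis
    unfolding symplectic_on_def
  proof (intro conjI ballI allI impI)
    fix X Y
    show "smooth_on U (\<lambda>p. \<omega> p X Y)"
      by (rule smooth_on_cong[OF _ U \<omega>[symmetric]])
        (auto simp: sum_2 intro!: smooth_on_intros smooth U)
  next
    fix p X Y
    assume p: "p \<in> U"
    have "cnj (\<omega> p X Y) = \<omega> p X Y"
      by (simp add: \<omega>[OF p] sum_2 herm[OF p] algebra_simps)
    then show "\<omega> p X Y \<in> \<real>"
      by (simp add: Reals_cnj_iff)
    show "\<omega> p X Y = - \<omega> p Y X"
      by (simp add: \<omega>[OF p] sum_2 algebra_simps)
  next
    fix p X
    assume p: "p \<in> U"
    show "linear (\<omega> p X)"
      by (rule linearI) (simp_all add: \<omega>[OF p] sum_2 zeta_simps scaleR_conv_of_real algebra_simps)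
  next
    fix p X
    assume p: "p \<in> U" and "X \<noteq> (0 :: complex \<times> complex)"
    define \<xi> :: "complex^2" where "\<xi> = (\<chi> \<alpha>. zeta \<alpha> X)"
    have "\<xi> \<noteq> 0"
      using \<open>X \<noteq> 0\<close> by (auto simp: \<xi>_def vec_eq_iff forall_2 zeta_simps prod_eq_iff)
    then have "0 < Re (\<Sum>\<alpha>\<in>UNIV. \<Sum>\<beta>\<in>UNIV. h p $ \<alpha> $ \<beta> * \<xi> $ \<alpha> * cnj (\<xi> $ \<beta>))"
      using h p unfolding kahler_with_def by blast
    \<comment> \<open>Both terms of each wedge product contribute \<open>- \<i>\<close>, and the
      prefactor \<open>\<i>\<close> turns the sum into \<open>2\<close>.\<close>
    moreover have "\<omega> p X (\<i> * fst X, \<i> * snd X) =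
        2 * (\<Sum>\<alpha>\<in>UNIV. \<Sum>\<beta>\<in>UNIV. h p $ \<alpha> $ \<beta> * \<xi> $ \<alpha> * cnj (\<xi> $ \<beta>))"
      by (simp add: \<omega>[OF p] \<xi>_def sum_2 zeta_simps algebra_simps)
    ultimately have "0 < Re (\<omega> p X (\<i> * fst X, \<i> * snd X))"
      by simp
    then show "\<exists>Y. \<omega> p X Y \<noteq> 0"
      by (intro exI[of _ "(\<i> * fst X, \<i> * snd X)"]) auto
  next
    fix p X Y Z
    assume "p \<in> U"
    then show "ed2 \<omega> p X Y Z = 0"
      using h unfolding kahler_with_def by blast
  qed
qed

text \<open>If \<open>F\<close> multiplies \<open>d\<zeta>\<^sub>1\<close> by \<open>c\<close> and
  \<open>\<theta>\<close> by \<open>d\<close>, the areas scale by the squared moduli, which the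
  coefficients have to absorb. This reduces invariance on the disk and on the half-plane to
  computing \<open>c\<close> and \<open>d\<close>.\<close>

lemma pullback_fibred_form:
  assumes F: "(F has_derivative F') (at p)"
    and base: "\<And>X. fst (F' X) = c * fst X"
    and fibre: "\<And>X. snd (F' X) + e' (F p) * fst (F' X) = d * (snd X + e p * fst X)"
    and "f' (F p) * (cmod c)\<^sup>2 = f p" and "g' (F p) * (cmod d)\<^sup>2 = g p"
  shows "pullback2 F (fibred_form f' g' e') p X Y = fibred_form f g e p X Y"
  unfolding pullback2_def fibred_form_def frechet_derivative_eqI[OF F] fibre
  unfolding base area_scale assms(4,5)[symmetric]
  by (simp add: algebra_simps)

section \<open>The Siegel--Jacobi disk\<close>

lemma in_SJ_disk: "p \<in> SJ_disk \<longleftrightarrow> cmod (fst p) < 1"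
  by (cases p) (simp add: SJ_disk_def siegel_disk_def)

lemma in_SJ_disk_iff_P_fun: "p \<in> SJ_disk \<longleftrightarrow> 0 < P_fun (fst p)"
  by (simp add: in_SJ_disk P_fun_def abs_square_less_1)

lemma open_SJ_disk: "open SJ_disk"
  unfolding SJ_disk_def siegel_disk_def
  by (intro open_Times open_UNIV open_Collect_less continuous_intros)

lemma of_real_P_fun: "complex_of_real (P_fun w) = 1 - w * cnj w"
  by (simp only: P_fun_def of_real_diff of_real_1 complex_norm_square)

text \<open>The squared modulus is expanded into real and imaginary parts, since \<open>cmod\<close>
  by itself is not smooth at \<open>0\<close>.\<close>

lemma smooth_on_P_fun: "open U \<Longrightarrow> smooth_on U (\<lambda>p. P_fun (fst p))"
  unfolding P_fun_def cmod_power2 by (intro smooth_on_intros)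

lemma smooth_on_eta_fun: "smooth_on SJ_disk eta_fun"
proof -
  have "smooth_on SJ_disk (\<lambda>p. (snd p + cnj (snd p) * fst p) / complex_of_real (P_fun (fst p)))"
    by (intro smooth_on_intros smooth_on_P_fun open_SJ_disk) (auto simp: in_SJ_disk_iff_P_fun)
  then show ?thesis
    by (simp add: eta_fun_def case_prod_unfold)
qed

text \<open>For \<open>z = \<eta> - w cnj \<eta>\<close> the numerator \<open>z + w cnj z\<close>
  collapses to \<open>(1 - w cnj w) \<eta>\<close>.\<close>

lemma eta_fun_FC:
  assumes "p \<in> SJ_disk"
  shows "eta_fun (FC p) = snd p"
proof -
  have "complex_of_real (P_fun (fst p)) \<noteq> 0"
    using assms by (simp add: in_SJ_disk_iff_P_fun)
  then show ?thesis
    by (simp add: eta_fun_def FC_def case_prod_unfold of_real_P_fun field_simps)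
qed

lemma fst_FC: "fst (FC p) = fst p"
  by (simp add: FC_def case_prod_unfold)

lemma FC_in_SJ_disk: "FC p \<in> SJ_disk \<longleftrightarrow> p \<in> SJ_disk"
  by (simp add: in_SJ_disk fst_FC)

lemma FC_inv_in_SJ_disk: "FC_inv p \<in> SJ_disk \<longleftrightarrow> p \<in> SJ_disk"
  by (simp add: in_SJ_disk FC_inv_def case_prod_unfold)

lemma eta_fun_times_P_fun:
  assumes "p \<in> SJ_disk"
  shows "eta_fun p * P_fun (fst p) = snd p + cnj (snd p) * fst p"
  using assms by (simp add: eta_fun_def case_prod_unfold in_SJ_disk_iff_P_fun)

text \<open>After multiplication by \<open>P_fun\<close>, the defining equation of
  \<open>\<eta>\<close> and its conjugate form a linear system from which \<open>cnj z\<close> is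
  eliminated.\<close>

lemma snd_eq_eta_fun:
  assumes "p \<in> SJ_disk"
  shows "snd p = eta_fun p - fst p * cnj (eta_fun p)"
proof -
  note num = eta_fun_times_P_fun[OF assms]
  have "cnj (eta_fun p) * P_fun (fst p) = cnj (snd p) + snd p * cnj (fst p)"
    using arg_cong[OF num, of cnj] by simp
  then have "(eta_fun p - fst p * cnj (eta_fun p)) * P_fun (fst p) = snd p * P_fun (fst p)"
    using num unfolding of_real_P_fun by algebra
  moreover have "complex_of_real (P_fun (fst p)) \<noteq> 0"
    using assms by (simp add: in_SJ_disk_iff_P_fun)
  ultimately show ?thesis by simp
qed

lemma FC_FC_inv: "p \<in> SJ_disk \<Longrightarrow> FC (FC_inv p) = p"
  by (simp add: FC_def FC_inv_def prod_eq_iff case_prod_unfold snd_eq_eta_fun[symmetric])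

lemma FC_inv_FC: "p \<in> SJ_disk \<Longrightarrow> FC_inv (FC p) = p"
  by (simp add: FC_inv_def case_prod_unfold fst_FC eta_fun_FC)

lemma change_of_variables_FC: "change_of_variables SJ_disk SJ_disk FC FC_inv"
  unfolding change_of_variables_def
proof (intro conjI)
  show "smooth_on SJ_disk FC"
    unfolding FC_def case_prod_unfold by (intro smooth_on_intros open_SJ_disk)
  show "smooth_on SJ_disk FC_inv"
    unfolding FC_inv_def case_prod_unfold prod.collapse
    by (intro smooth_on_intros smooth_on_eta_fun open_SJ_disk)
qed (auto simp: FC_in_SJ_disk FC_inv_in_SJ_disk FC_FC_inv FC_inv_FC)

lemma has_derivative_FC:
  "(FC has_derivative (\<lambda>X. (fst X, snd X - (fst X * cnj (snd p) + fst p * cnj (snd X))))) (at p)"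
  unfolding FC_def case_prod_unfold
  by (rule derivative_eq_intros refl)+ (simp add: add.commute)

lemma A_form_eq: "A_form p X = snd X + cnj (eta_fun p) * fst X"
  by (simp add: A_form_def ed_fst ed_snd)

text \<open>The term \<open>- cnj \<eta> dw\<close> from differentiating
  \<open>- w cnj \<eta>\<close> cancels the \<open>dw\<close> term of \<open>A_form\<close>, because
  \<open>eta_fun\<close> takes the value \<open>\<eta>\<close> at the image point.\<close>

lemma pullback_FC_A_form:
  assumes "p \<in> SJ_disk"
  shows "pullback1 FC A_form p X = snd X - fst p * cnj (snd X)"
  by (simp add: pullback1_def frechet_derivative_eqI[OF has_derivative_FC] A_form_eq
      eta_fun_FC[OF assms])

lemma omega_disk_eq:
  "omega_disk k \<nu> = fibred_form (\<lambda>p. 2 * k / (P_fun (fst p))\<^sup>2) (\<lambda>p. \<nu> / P_fun (fst p)) (\<lambda>p. cnj (eta_fun p))"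
  by (intro ext)
    (simp add: omega_disk_def fibred_form_def wedge_def cnj1_def ed_fst A_form_eq area_def)

section \<open>Derivatives of the coefficients and closedness on the disk\<close>

lemma has_derivative_P_fun:
  "((\<lambda>q. complex_of_real (P_fun (fst q))) has_derivative
    (\<lambda>X. - (cnj (fst p) * fst X + fst p * cnj (fst X)))) (at p)"
  unfolding of_real_P_fun by (rule derivative_eq_intros refl)+ (simp add: fun_eq_iff)

text \<open>Written with the logarithmic derivative factored out, so that \<open>cnj w / P\<close>
  can be read off as the \<open>e2\<close> of \<open>ed2_fibred_form\<close>.\<close>

lemma has_derivative_disk_coeff:
  assumes "p \<in> SJ_disk"
  shows "((\<lambda>q. complex_of_real (c / P_fun (fst q))) has_derivative
    (\<lambda>X. of_real (c / P_fun (fst p)) *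
      (cnj (fst p) / P_fun (fst p) * fst X + cnj (cnj (fst p) / P_fun (fst p)) * cnj (fst X)))) (at p)"
proof -
  have "complex_of_real (P_fun (fst p)) \<noteq> 0"
    using assms by (simp add: in_SJ_disk_iff_P_fun)
  then show ?thesis
    unfolding of_real_divide
    by (intro has_derivative_eq_rhs[OF has_derivative_divide'[OF has_derivative_const has_derivative_P_fun]])
      (simp_all add: fun_eq_iff field_simps)
qed

lemma has_derivative_disk_coeff_power2:
  assumes "p \<in> SJ_disk"
  shows "((\<lambda>q. complex_of_real (c / (P_fun (fst q))\<^sup>2)) has_derivative
    (\<lambda>X. 2 * c * cnj (fst p) / P_fun (fst p) ^ 3 * fst X
      + cnj (2 * c * cnj (fst p) / P_fun (fst p) ^ 3) * cnj (fst X))) (at p)"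
proof -
  have "complex_of_real (P_fun (fst p)) \<noteq> 0"
    using assms by (simp add: in_SJ_disk_iff_P_fun)
  then show ?thesis
    unfolding of_real_divide of_real_power unfolding power2_eq_square
    by (intro has_derivative_eq_rhs[OF has_derivative_divide'[OF has_derivative_const
            has_derivative_mult[OF has_derivative_P_fun has_derivative_P_fun]]])
      (simp_all add: fun_eq_iff field_simps power3_eq_cube)
qed

text \<open>This is the relation \<open>A = d\<eta> - w cnj d\<eta>\<close> solved for
  \<open>d\<eta>\<close>. It is verified by the quotient rule after expressing \<open>z\<close>
  through \<open>\<eta>\<close>.\<close>

lemma has_derivative_eta_fun:
  assumes p: "p \<in> SJ_disk"
  shows "(eta_fun has_derivative (\<lambda>X. (A_form p X + fst p * cnj (A_form p X)) / P_fun (fst p))) (at p)"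
proof -
  define P where "P = complex_of_real (P_fun (fst p))"
  have nz: "P \<noteq> 0"
    using assms by (simp add: P_def in_SJ_disk_iff_P_fun)
  have "((\<lambda>q. snd q + cnj (snd q) * fst q) has_derivative
      (\<lambda>X. snd X + (cnj (snd p) * fst X + cnj (snd X) * fst p))) (at p)"
    by (rule derivative_eq_intros refl)+
  note has_derivative_divide'[OF this has_derivative_P_fun nz[unfolded P_def]]
  then have "(eta_fun has_derivative
    (\<lambda>X. ((snd X + (cnj (snd p) * fst X + cnj (snd X) * fst p)) * P
      - eta_fun p * P * - (cnj (fst p) * fst X + fst p * cnj (fst X))) / (P * P))) (at p)"
    by (simp add: P_def eta_fun_times_P_fun[OF p]) (simp add: eta_fun_def case_prod_unfold[abs_def])
  moreover have "((snd X + (cnj (snd p) * fst X + cnj (snd X) * fst p)) * P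
      - eta_fun p * P * - (cnj (fst p) * fst X + fst p * cnj (fst X))) / (P * P)
    = (A_form p X + fst p * cnj (A_form p X)) / P" for X
    using nz by (subst snd_eq_eta_fun[OF p])+ (simp add: A_form_eq field_simps)
  ultimately show ?thesis by (simp add: P_def)
qed

text \<open>Here \<open>e\<close> is \<open>cnj \<eta>\<close>, with differential
  \<open>(cnj A + cnj w A) / P\<close>. Its \<open>A\<close> coefficient \<open>cnj w / P\<close> is
  the logarithmic derivative of \<open>\<nu> / P\<close>, as closedness requires.\<close>

lemma ed2_omega_disk:
  assumes p: "p \<in> SJ_disk"
  shows "ed2 (omega_disk k \<nu>) p X Y Z = 0"
proof (rule ed2_fibred_form[OF open_SJ_disk p])
  show "((\<lambda>q. cnj (eta_fun q)) has_derivative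
    (\<lambda>X. cnj (fst p) * cnj (eta_fun p) / P_fun (fst p) * fst X + cnj (fst p) / P_fun (fst p) * snd X
      + 1 / P_fun (fst p) * (cnj (snd X) + cnj (cnj (eta_fun p)) * cnj (fst X)))) (at p)"
    by (rule has_derivative_eq_rhs[OF has_derivative_cnj[OF has_derivative_eta_fun[OF p]]])
      (simp add: fun_eq_iff A_form_eq add_divide_distrib algebra_simps)
qed (rule omega_disk_eq[THEN fun_cong, THEN fun_cong, THEN fun_cong]
    has_derivative_disk_coeff[OF p] has_derivative_disk_coeff_power2[OF p])+

lemma kahler_with_omega_disk:
  assumes "0 < k" and "0 < \<nu>"
  shows "kahler_with SJ_disk (fibred_matrix (\<lambda>p. 2 * k / (P_fun (fst p))\<^sup>2) (\<lambda>p. \<nu> / P_fun (fst p))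
    (\<lambda>p. cnj (eta_fun p))) (omega_disk k \<nu>)"
  by (rule kahler_with_fibred_form)
    (use assms in \<open>auto simp: omega_disk_eq[symmetric] in_SJ_disk_iff_P_fun
      intro!: smooth_on_intros smooth_on_P_fun smooth_on_eta_fun open_SJ_disk ed2_omega_disk\<close>)

lemma is_kahler_with_metric_disk:
  assumes "0 < k" and "0 < \<nu>"
  shows "is_kahler_with_metric SJ_disk (metric_disk k \<nu>) (omega_disk k \<nu>)"
  unfolding is_kahler_with_metric_def
  using kahler_with_omega_disk[OF assms]
  by (intro exI conjI) (auto simp: fibred_matrix_line_element metric_disk_def ed_fst A_form_eq)

section \<open>The forms in the coordinates \<open>(w, \<eta>)\<close>\<close>

lemma pullback_FC_omega_disk:
  assumes p: "p \<in> SJ_disk"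
  shows "pullback2 FC (omega_disk k \<nu>) p X Y =
    fibred_form (\<lambda>p. 2 * k / (P_fun (fst p))\<^sup>2) (\<lambda>p. \<nu>) (\<lambda>p. 0) p X Y"
proof -
  \<comment> \<open>The real-linear map sending \<open>x\<close> to \<open>x - w cnj x\<close> has
    determinant \<open>1 - |w|^2\<close>, which cancels the denominator in the second
    coefficient.\<close>
  have "area (snd X - fst p * cnj (snd X)) (snd Y - fst p * cnj (snd Y)) =
    of_real (P_fun (fst p)) * area (snd X) (snd Y)"
    by (simp add: area_def of_real_P_fun algebra_simps)
  moreover have "complex_of_real (P_fun (fst p)) \<noteq> 0"
    using p by (simp add: in_SJ_disk_iff_P_fun)
  ultimately show ?thesis
    by (simp add: pullback2_def frechet_derivative_eqI[OF has_derivative_FC] omega_disk_eq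
        fibred_form_def eta_fun_FC[OF p] fst_FC)
qed

lemma ed2_pullback_FC_omega_disk:
  assumes p: "p \<in> SJ_disk"
  shows "ed2 (pullback2 FC (omega_disk k \<nu>)) p X Y Z = 0"
proof (rule ed2_fibred_form[OF open_SJ_disk p])
  show "((\<lambda>q. complex_of_real \<nu>) has_derivative
      (\<lambda>X. of_real \<nu> * (0 * fst X + cnj 0 * cnj (fst X)))) (at p)"
    by simp
  show "((\<lambda>q. 0) has_derivative
      (\<lambda>X. 0 * fst X + 0 * snd X + 0 * (cnj (snd X) + cnj 0 * cnj (fst X)))) (at p)"
    by simp
qed (rule pullback_FC_omega_disk has_derivative_disk_coeff_power2[OF p] | assumption)+

text \<open>An intermediate result towards \<open>symplectic_on\<close>. It does not conflict with
  the failure of the Kaehler property after \<open>FC\<close>, which concerns the form together with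
  its line element.\<close>

lemma is_kahler_pullback_FC_omega_disk:
  assumes "0 < k" and "0 < \<nu>"
  shows "is_kahler SJ_disk (pullback2 FC (omega_disk k \<nu>))"
  unfolding is_kahler_def
proof (rule exI, rule kahler_with_fibred_form)
  show "pullback2 FC (omega_disk k \<nu>) p X Y =
      fibred_form (\<lambda>p. 2 * k / (P_fun (fst p))\<^sup>2) (\<lambda>p. \<nu>) (\<lambda>p. 0) p X Y"
    if "p \<in> SJ_disk" for p X Y
    using that by (rule pullback_FC_omega_disk)
qed (use assms in \<open>auto simp: in_SJ_disk_iff_P_fun
      intro!: smooth_on_intros smooth_on_P_fun open_SJ_disk ed2_pullback_FC_omega_disk\<close>)

text \<open>
  At \<open>(w, \<eta>) = (1/2, 0)\<close> the pulled back line element is a multiple of \<open>|d\<eta> - (1/2) d(cnj \<eta>)|\<^sup>2\<close> on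
  vertical vectors. Its values at \<open>1\<close> and \<open>\<i>\<close> differ, so it is not Hermitian.
\<close>

lemma not_kahler_with_metric_pullback_FC:
  assumes "0 < \<nu>"
  shows "\<not> is_kahler_with_metric SJ_disk (pullback_line FC (metric_disk k \<nu>)) \<omega>"
proof
  assume "is_kahler_with_metric SJ_disk (pullback_line FC (metric_disk k \<nu>)) \<omega>"
  then obtain h where h: "\<And>p X. p \<in> SJ_disk \<Longrightarrow>
      complex_of_real (pullback_line FC (metric_disk k \<nu>) p X) =
      (\<Sum>\<alpha>\<in>UNIV. \<Sum>\<beta>\<in>UNIV. h p $ \<alpha> $ \<beta> * ed (zeta \<alpha>) p X * cnj (ed (zeta \<beta>) p X))"
    unfolding is_kahler_with_metric_def by blast
  define p :: "complex \<times> complex" where "p = (1 / 2, 0)"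
  have p: "p \<in> SJ_disk"
    by (simp add: p_def in_SJ_disk)
  have line: "pullback_line FC (metric_disk k \<nu>) p (0, x) = \<nu> / P_fun (1 / 2) * (cmod (x - 1 / 2 * cnj x))\<^sup>2" for x
    using pullback_FC_A_form[OF p, of "(0, x)"]
    by (simp add: pullback_line_def metric_disk_def pullback1_def fst_FC ed_fst
        frechet_derivative_eqI[OF has_derivative_FC]) (simp add: p_def)
  \<comment> \<open>A Hermitian expression cannot distinguish \<open>(0, 1)\<close> from
    \<open>(0, \<i>)\<close>: both give the entry \<open>h p $ 2 $ 2\<close>.\<close>
  have "complex_of_real (pullback_line FC (metric_disk k \<nu>) p (0, 1)) =
      of_real (pullback_line FC (metric_disk k \<nu>) p (0, \<i>))"
    unfolding h[OF p] by (simp add: ed_zeta sum_2 zeta_simps mult.assoc)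
  \<comment> \<open>The two sides are \<open>1/4\<close> and \<open>9/4\<close>; the common factor
    \<open>\<nu> / P_fun (1 / 2)\<close> is positive and cancels.\<close>
  then have "(cmod (1 - 1 / 2))\<^sup>2 = (cmod (\<i> + 1 / 2 * \<i>))\<^sup>2"
    unfolding of_real_eq_iff line using assms p
    by (simp add: in_SJ_disk_iff_P_fun) (simp add: p_def)
  then show False
    by (simp add: cmod_power2 power2_eq_square)
qed

section \<open>The action of the Jacobi group on the disk\<close>

lemma SU11_D:
  assumes "g \<in> SU11"
  shows "g $ 2 $ 1 = cnj (g $ 1 $ 2)" "g $ 2 $ 2 = cnj (g $ 1 $ 1)"
    "g $ 1 $ 1 * cnj (g $ 1 $ 1) - g $ 1 $ 2 * cnj (g $ 1 $ 2) = 1"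
  using assms by (auto simp: SU11_def det_2)

lemma mat_1_in_SU11: "mat 1 \<in> SU11"
  by (simp add: SU11_def mat_def det_2)

lemma SU11_mult: "g \<in> SU11 \<Longrightarrow> h \<in> SU11 \<Longrightarrow> g ** h \<in> SU11"
  by (simp add: SU11_def det_mul) (simp add: matrix_matrix_mult_def sum_2 add.commute)

text \<open>\<open>matrix_inv\<close> is given by a choice; since a left inverse of a square matrix
  over a field is two-sided, the chosen inverse must be \<open>B\<close>.\<close>

lemma matrix_inv_eqI:
  fixes A B :: "'a::field^'n^'n"
  assumes "B ** A = mat 1"
  shows "matrix_inv A = B"
proof -
  have "A ** B = mat 1"
    using assms by (simp add: matrix_left_right_inverse)
  then have "A ** matrix_inv A = mat 1"
    unfolding matrix_inv_def using assms
    by (metis (mono_tags, lifting) someI_ex)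
  then show ?thesis
    using assms by (metis matrix_mul_assoc matrix_mul_lid matrix_mul_rid)
qed

lemma SU11_inverse:
  assumes "g \<in> SU11"
  shows "matrix_inv g \<in> SU11" and "matrix_inv g ** g = mat 1" and "g ** matrix_inv g = mat 1"
proof -
  \<comment> \<open>The adjugate of \<open>g\<close>, which is its inverse as the determinant is
    1.\<close>
  define h :: "complex^2^2" where
    "h = vector [vector [cnj (g $ 1 $ 1), - g $ 1 $ 2], vector [- cnj (g $ 1 $ 2), g $ 1 $ 1]]"
  note g = SU11_D[OF assms]
  have "h ** g = mat 1"
    using g(3) by (simp add: h_def vec_eq_iff forall_2 matrix_matrix_mult_def sum_2 mat_def g(1,2) algebra_simps)
  then have h: "matrix_inv g = h"
    by (rule matrix_inv_eqI)
  show "matrix_inv g \<in> SU11"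
    using g(3) by (simp add: h SU11_def det_2 h_def algebra_simps)
  show "matrix_inv g ** g = mat 1"
    using \<open>h ** g = mat 1\<close> by (simp add: h)
  then show "g ** matrix_inv g = mat 1"
    by (simp add: matrix_left_right_inverse)
qed

text \<open>Membership of \<open>h\<close> in \<open>SU11\<close> makes it preserve vectors of the
  shape \<open>(\<alpha>, cnj \<alpha>)\<close>, so that \<open>su_act\<close> is matrix
  multiplication on them.\<close>

lemma su_act_mult: "h \<in> SU11 \<Longrightarrow> su_act (g ** h) \<alpha> = su_act g (su_act h \<alpha>)"
  using SU11_D[of h] by (simp add: su_act_def matrix_matrix_mult_def sum_2 algebra_simps)

lemma su_act_mat_1: "su_act (mat 1) \<alpha> = \<alpha>"
  by (simp add: su_act_def mat_def)

lemma su_act_add: "su_act g (\<alpha> + \<beta>) = su_act g \<alpha> + su_act g \<beta>"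
  by (simp add: su_act_def algebra_simps)

lemma su_act_matrix_inv:
  assumes "g \<in> SU11"
  shows "su_act (matrix_inv g) (su_act g \<alpha>) = \<alpha>" and "su_act g (su_act (matrix_inv g) \<alpha>) = \<alpha>"
  using SU11_inverse[OF assms] assms by (simp_all add: su_act_mult[symmetric] su_act_mat_1)

text \<open>Reversal of the order is obtained from cancellation on the level of the action, without
  computing the inverse matrix of a product.\<close>

lemma su_act_matrix_inv_mult:
  assumes "g \<in> SU11" and "h \<in> SU11"
  shows "su_act (matrix_inv (g ** h)) \<alpha> = su_act (matrix_inv h) (su_act (matrix_inv g) \<alpha>)"
  using su_act_matrix_inv(2)[OF assms(1), of \<alpha>]
    su_act_matrix_inv(2)[OF assms(2), of "su_act (matrix_inv g) \<alpha>"]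
    su_act_matrix_inv(1)[OF SU11_mult[OF assms], of "su_act (matrix_inv h) (su_act (matrix_inv g) \<alpha>)"]
  by (simp add: su_act_mult assms)

lemma GJ0_simps:
  "carrier GJ0 = SU11 \<times> UNIV" "\<one>\<^bsub>GJ0\<^esub> = (mat 1, 0)"
  "(g, \<alpha>) \<otimes>\<^bsub>GJ0\<^esub> (h, \<beta>) = (g ** h, su_act (matrix_inv h) \<alpha> + \<beta>)"
  by (simp_all add: GJ0_def)

lemma group_GJ0: "group GJ0"
proof (rule groupI)
  fix a b c
  assume "a \<in> carrier GJ0" "b \<in> carrier GJ0" "c \<in> carrier GJ0"
  then show "a \<otimes>\<^bsub>GJ0\<^esub> b \<otimes>\<^bsub>GJ0\<^esub> c = a \<otimes>\<^bsub>GJ0\<^esub> (b \<otimes>\<^bsub>GJ0\<^esub> c)"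
    by (cases a; cases b; cases c)
      (simp add: GJ0_simps matrix_mul_assoc su_act_matrix_inv_mult su_act_add)
next
  fix a
  assume a: "a \<in> carrier GJ0"
  obtain g \<alpha> where ga: "a = (g, \<alpha>)" and g: "g \<in> SU11"
    using a by (cases a) (auto simp: GJ0_simps)
  show "\<exists>b\<in>carrier GJ0. b \<otimes>\<^bsub>GJ0\<^esub> a = \<one>\<^bsub>GJ0\<^esub>"
  proof
    \<comment> \<open>The group law twists the first translation by \<open>matrix_inv g\<close>, so
      the left inverse must carry the translation \<open>- su_act g \<alpha>\<close>.\<close>
    have "su_act (matrix_inv g) (- su_act g \<alpha>) = - \<alpha>"
      using su_act_matrix_inv(1)[OF g, of "- \<alpha>"] by (simp add: su_act_def)
    then show "(matrix_inv g, - su_act g \<alpha>) \<otimes>\<^bsub>GJ0\<^esub> a = \<one>\<^bsub>GJ0\<^esub>"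
      by (simp add: ga GJ0_simps SU11_inverse[OF g])
  qed (simp add: GJ0_simps SU11_inverse[OF g])
qed (auto simp: GJ0_simps SU11_mult mat_1_in_SU11 su_act_def)

lemma disk_act_eq:
  "disk_act (g, \<alpha>) p = ((g $ 1 $ 1 * fst p + g $ 1 $ 2) / (cnj (g $ 1 $ 2) * fst p + cnj (g $ 1 $ 1)),
     (snd p + \<alpha> - cnj \<alpha> * fst p) / (cnj (g $ 1 $ 2) * fst p + cnj (g $ 1 $ 1)))"
  by (simp add: disk_act_def Let_def case_prod_unfold)

lemma disk_eta_act_eq:
  "disk_eta_act (g, \<alpha>) p = ((g $ 1 $ 1 * fst p + g $ 1 $ 2) / (cnj (g $ 1 $ 2) * fst p + cnj (g $ 1 $ 1)),
     su_act g (snd p + \<alpha>))"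
  by (simp add: disk_eta_act_def Let_def case_prod_unfold su_act_def)

lemma disk_eta_act_one: "disk_eta_act (mat 1, 0) p = p"
  by (simp add: disk_eta_act_eq su_act_mat_1) (simp add: mat_def)

text \<open>\<open>SU(1,1)\<close> preserves the indefinite Hermitian form, so
  \<open>|J|^2 - |N|^2 = 1 - |w|^2\<close> for denominator \<open>J\<close> and numerator
  \<open>N\<close>. Both claims follow from this identity.\<close>

lemma P_fun_moebius:
  assumes g: "g \<in> SU11" and w: "0 < P_fun w"
  defines "J \<equiv> cnj (g $ 1 $ 2) * w + cnj (g $ 1 $ 1)"
  shows "J \<noteq> 0" and "P_fun ((g $ 1 $ 1 * w + g $ 1 $ 2) / J) = P_fun w / (cmod J)\<^sup>2"
proof -
  define N where "N = g $ 1 $ 1 * w + g $ 1 $ 2"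
  have "J * cnj J - N * cnj N = 1 - w * cnj w"
    using SU11_D(3)[OF g] unfolding J_def N_def complex_cnj_add complex_cnj_mult complex_cnj_cnj
    by algebra
  then have "complex_of_real ((cmod J)\<^sup>2 - (cmod N)\<^sup>2) = of_real (P_fun w)"
    by (simp only: of_real_P_fun of_real_diff complex_norm_square)
  then have *: "(cmod J)\<^sup>2 - (cmod N)\<^sup>2 = P_fun w"
    by (simp only: of_real_eq_iff)
  show J: "J \<noteq> 0"
  proof
    assume "J = 0"
    then show False using * w zero_le_power2[of "cmod N"] by simp
  qed
  have "P_fun (N / J) = P_fun w / (cmod J)\<^sup>2"
    using J *[unfolded P_fun_def] by (simp add: P_fun_def norm_divide power_divide field_simps)
  then show "P_fun ((g $ 1 $ 1 * w + g $ 1 $ 2) / J) = P_fun w / (cmod J)\<^sup>2"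
    by (simp add: N_def)
qed

text \<open>The cocycle relation: numerator and denominator of \<open>g ** h\<close> at
  \<open>w\<close> are those of \<open>g\<close> at \<open>w'\<close>, both multiplied by the
  denominator \<open>J\<close> of \<open>h\<close> at \<open>w\<close>.\<close>

lemma moebius_mult:
  assumes g: "g \<in> SU11" and h: "h \<in> SU11" and w: "0 < P_fun w"
  defines "w' \<equiv> (h $ 1 $ 1 * w + h $ 1 $ 2) / (cnj (h $ 1 $ 2) * w + cnj (h $ 1 $ 1))"
  shows "((g ** h) $ 1 $ 1 * w + (g ** h) $ 1 $ 2) / (cnj ((g ** h) $ 1 $ 2) * w + cnj ((g ** h) $ 1 $ 1))
    = (g $ 1 $ 1 * w' + g $ 1 $ 2) / (cnj (g $ 1 $ 2) * w' + cnj (g $ 1 $ 1))"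
proof -
  define J where "J = cnj (h $ 1 $ 2) * w + cnj (h $ 1 $ 1)"
  have J: "J \<noteq> 0"
    using P_fun_moebius(1)[OF h w] by (simp add: J_def)
  have w': "w' * J = h $ 1 $ 1 * w + h $ 1 $ 2"
    using J by (simp add: w'_def J_def)
  have "(g ** h) $ 1 $ 1 * w + (g ** h) $ 1 $ 2 = (g $ 1 $ 1 * w' + g $ 1 $ 2) * J"
    using SU11_D(1,2)[OF h] unfolding distrib_right mult.assoc w'
    by (simp add: J_def matrix_matrix_mult_def sum_2 algebra_simps)
  moreover have "cnj ((g ** h) $ 1 $ 2) * w + cnj ((g ** h) $ 1 $ 1) = (cnj (g $ 1 $ 2) * w' + cnj (g $ 1 $ 1)) * J"
    using SU11_D(1,2)[OF h] unfolding distrib_right mult.assoc w'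
    by (simp add: J_def matrix_matrix_mult_def sum_2 algebra_simps)
  ultimately show ?thesis using J by simp
qed

lemma disk_eta_act_in_SJ_disk:
  assumes "g \<in> SU11" and "p \<in> SJ_disk"
  shows "disk_eta_act (g, \<alpha>) p \<in> SJ_disk"
  using P_fun_moebius[OF assms(1), of "fst p"] assms(2)
  by (simp add: in_SJ_disk_iff_P_fun disk_eta_act_eq)

text \<open>In the coordinate \<open>\<eta>\<close> the fibres are moved by real affine maps
  independent of \<open>w\<close>, so the action law is linear algebra. It is proved here first and
  carried over to \<open>disk_act\<close> through \<open>FC\<close>.\<close>

lemma group_action_disk_eta_act: "group_action GJ0 SJ_disk (\<lambda>g. restrict (disk_eta_act g) SJ_disk)"
proof (rule group_actionI[OF group_GJ0])
  fix a b p
  assume "a \<in> carrier GJ0" "b \<in> carrier GJ0" and p: "p \<in> SJ_disk"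
  then obtain g \<alpha> h \<beta> where ab: "a = (g, \<alpha>)" "b = (h, \<beta>)" and g: "g \<in> SU11" and h: "h \<in> SU11"
    by (cases a; cases b) (auto simp: GJ0_simps)
  have "su_act (g ** h) (snd p + (su_act (matrix_inv h) \<alpha> + \<beta>)) = su_act g (su_act h (snd p + \<beta>) + \<alpha>)"
    by (simp add: su_act_mult h su_act_add su_act_matrix_inv algebra_simps)
  then show "disk_eta_act (a \<otimes>\<^bsub>GJ0\<^esub> b) p = disk_eta_act a (disk_eta_act b p)"
    using moebius_mult[OF g h, of "fst p"] p
    by (simp add: ab GJ0_simps disk_eta_act_eq in_SJ_disk_iff_P_fun)
qed (auto simp: GJ0_simps disk_eta_act_one disk_eta_act_in_SJ_disk)

lemma FC_eq: "FC p = (fst p, snd p - fst p * cnj (snd p))"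
  by (simp add: FC_def case_prod_unfold)

text \<open>\<open>FC\<close> intertwines the two actions: for
  \<open>\<beta> = \<eta> + \<alpha>\<close>, the relation \<open>|P|^2 - |Q|^2 = 1\<close> turns
  \<open>\<beta> - w cnj \<beta>\<close> into \<open>J\<close> times the same expression at the
  image point.\<close>

lemma disk_act_FC:
  assumes g: "g \<in> SU11" and p: "p \<in> SJ_disk"
  shows "disk_act (g, \<alpha>) (FC p) = FC (disk_eta_act (g, \<alpha>) p)"
proof -
  define w where "w = fst p"
  define \<beta> where "\<beta> = snd p + \<alpha>"
  define J where "J = cnj (g $ 1 $ 2) * w + cnj (g $ 1 $ 1)"
  have J: "J \<noteq> 0"
    using P_fun_moebius(1)[OF g, of w] p by (simp add: J_def w_def in_SJ_disk_iff_P_fun)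
  have "\<beta> - w * cnj \<beta> = su_act g \<beta> * J - (g $ 1 $ 1 * w + g $ 1 $ 2) * cnj (su_act g \<beta>)"
    using SU11_D(3)[OF g]
    unfolding J_def su_act_def complex_cnj_add complex_cnj_mult complex_cnj_cnj by algebra
  then have "(\<beta> - w * cnj \<beta>) / J = su_act g \<beta> - (g $ 1 $ 1 * w + g $ 1 $ 2) / J * cnj (su_act g \<beta>)"
    using J by (simp add: field_simps)
  moreover have "snd (FC p) + \<alpha> - cnj \<alpha> * w = \<beta> - w * cnj \<beta>"
    by (simp add: \<beta>_def w_def FC_def case_prod_unfold algebra_simps)
  ultimately show ?thesis
    unfolding disk_act_eq FC_eq[of "disk_eta_act (g, \<alpha>) p"]
    by (simp add: disk_eta_act_eq fst_FC w_def[symmetric] J_def[symmetric] \<beta>_def[symmetric])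
qed

lemma disk_act_eq_FC:
  assumes "g \<in> SU11" and "p \<in> SJ_disk"
  shows "disk_act (g, \<alpha>) p = FC (disk_eta_act (g, \<alpha>) (FC_inv p))"
  using disk_act_FC[OF assms(1), of "FC_inv p" \<alpha>] assms(2)
  by (simp add: FC_inv_in_SJ_disk FC_FC_inv)

text \<open>Conjugation by \<open>FC\<close> transports the action laws from
  \<open>disk_eta_act\<close>.\<close>

lemma group_action_disk_act: "group_action GJ0 SJ_disk (\<lambda>g. restrict (disk_act g) SJ_disk)"
proof (rule group_actionI[OF group_GJ0])
  interpret group_action GJ0 SJ_disk "\<lambda>g. restrict (disk_eta_act g) SJ_disk"
    by (rule group_action_disk_eta_act)
  fix a b p
  assume a: "a \<in> carrier GJ0" and b: "b \<in> carrier GJ0" and p: "p \<in> SJ_disk"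
  then obtain g \<alpha> h \<beta> where ab: "a = (g, \<alpha>)" "b = (h, \<beta>)" and g: "g \<in> SU11" and h: "h \<in> SU11"
    by (cases a; cases b) (auto simp: GJ0_simps)
  have "disk_eta_act (a \<otimes>\<^bsub>GJ0\<^esub> b) (FC_inv p) = disk_eta_act a (disk_eta_act b (FC_inv p))"
    using composition_rule[of "FC_inv p" a b] a b p disk_eta_act_in_SJ_disk[OF h]
    by (simp add: ab FC_inv_in_SJ_disk)
  then show "disk_act (a \<otimes>\<^bsub>GJ0\<^esub> b) p = disk_act a (disk_act b p)"
    using g h p
    by (simp add: ab GJ0_simps disk_act_eq_FC SU11_mult FC_in_SJ_disk FC_inv_in_SJ_disk FC_inv_FC
        disk_eta_act_in_SJ_disk)
qed (auto simp: GJ0_simps disk_act_eq_FC mat_1_in_SU11 disk_eta_act_one FC_FC_inv FC_in_SJ_disk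
    FC_inv_in_SJ_disk disk_eta_act_in_SJ_disk)

section \<open>Derivatives of the actions and invariance on the disk\<close>

lemma has_derivative_moebius:
  fixes a b c d :: complex
  assumes "a * d - b * c = 1" and nz: "c * fst p + d \<noteq> 0"
  shows "((\<lambda>q. (a * fst q + b) / (c * fst q + d)) has_derivative
    (\<lambda>X. 1 / (c * fst p + d)\<^sup>2 * fst X)) (at (p :: complex \<times> complex))"
proof (rule has_derivative_eq_rhs[OF has_derivative_divide'])
  show "((\<lambda>q. a * fst q + b) has_derivative (\<lambda>X. a * fst X)) (at p)"
    "((\<lambda>q. c * fst q + d) has_derivative (\<lambda>X. c * fst X)) (at p)"
    by (auto intro!: derivative_eq_intros)
  have "a * fst X * (c * fst p + d) - (a * fst p + b) * (c * fst X) = fst X" for X :: "complex \<times> complex"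
    using assms(1) by algebra
  then show "(\<lambda>X :: complex \<times> complex. (a * fst X * (c * fst p + d) - (a * fst p + b) * (c * fst X)) /
      ((c * fst p + d) * (c * fst p + d))) = (\<lambda>X. 1 / (c * fst p + d)\<^sup>2 * fst X)"
    by (simp add: power2_eq_square)
qed (rule nz)

text \<open>Complex \<open>m\<close> and \<open>n\<close> cover both fibre actions:
  \<open>m = \<alpha>\<close>, \<open>n = - cnj \<alpha>\<close> on the disk, and real
  \<open>m\<close>, \<open>n\<close> on the half-plane.\<close>

lemma has_derivative_affine_over_affine:
  fixes m n c d :: complex
  assumes nz: "c * fst p + d \<noteq> 0"
  shows "((\<lambda>q. (snd q + m + n * fst q) / (c * fst q + d)) has_derivative
    (\<lambda>X. (snd X + n * fst X) / (c * fst p + d)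
       - (snd p + m + n * fst p) * c * fst X / (c * fst p + d)\<^sup>2)) (at (p :: complex \<times> complex))"
proof (rule has_derivative_eq_rhs[OF has_derivative_divide'])
  show "((\<lambda>q. snd q + m + n * fst q) has_derivative (\<lambda>X. snd X + n * fst X)) (at p)"
    "((\<lambda>q. c * fst q + d) has_derivative (\<lambda>X. c * fst X)) (at p)"
    by (auto intro!: derivative_eq_intros)
  show "(\<lambda>X. ((snd X + n * fst X) * (c * fst p + d) - (snd p + m + n * fst p) * (c * fst X)) /
      ((c * fst p + d) * (c * fst p + d))) = (\<lambda>X. (snd X + n * fst X) / (c * fst p + d)
       - (snd p + m + n * fst p) * c * fst X / (c * fst p + d)\<^sup>2)"
    using nz by (simp add: fun_eq_iff power2_eq_square diff_divide_distrib)
qed (rule nz)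

lemma invariant_omega_disk: "invariant_under (carrier GJ0) disk_act SJ_disk (omega_disk k \<nu>)"
  unfolding invariant_under_def
proof (intro ballI allI)
  fix a p X Y
  assume "a \<in> carrier GJ0" and p: "p \<in> SJ_disk"
  then obtain g \<alpha> where a: "a = (g, \<alpha>)" and g: "g \<in> SU11"
    by (cases a) (auto simp: GJ0_simps)
  define J where "J = cnj (g $ 1 $ 2) * fst p + cnj (g $ 1 $ 1)"
  define F' where "F' X = (1 / J\<^sup>2 * fst X, (snd X + - cnj \<alpha> * fst X) / J
    - (snd p + \<alpha> + - cnj \<alpha> * fst p) * cnj (g $ 1 $ 2) * fst X / J\<^sup>2)" for X :: "complex \<times> complex"
  have Pp: "0 < P_fun (fst p)"
    using p by (simp add: in_SJ_disk_iff_P_fun)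
  have J: "J \<noteq> 0" and P': "P_fun (fst (disk_act (g, \<alpha>) p)) = P_fun (fst p) / (cmod J)\<^sup>2"
    using P_fun_moebius[OF g Pp] by (simp_all add: J_def disk_act_eq)
  have F: "(disk_act a has_derivative F') (at p)"
    using J SU11_D(3)[OF g] has_derivative_Pair[OF has_derivative_moebius has_derivative_affine_over_affine,
        of "g $ 1 $ 1" "cnj (g $ 1 $ 1)" "g $ 1 $ 2" "cnj (g $ 1 $ 2)" p "cnj (g $ 1 $ 2)" "cnj (g $ 1 $ 1)" \<alpha> "- cnj \<alpha>"]
    by (simp add: a J_def[symmetric] disk_act_eq[abs_def] F'_def[abs_def])
  have eta: "eta_fun (disk_act (g, \<alpha>) p) = su_act g (eta_fun p + \<alpha>)"
    using g p by (simp add: disk_act_eq_FC eta_fun_FC disk_eta_act_in_SJ_disk FC_inv_in_SJ_disk)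
      (simp add: disk_eta_act_eq FC_inv_def case_prod_unfold)
  have "pullback2 (disk_act a) (fibred_form (\<lambda>p. 2 * k / (P_fun (fst p))\<^sup>2) (\<lambda>p. \<nu> / P_fun (fst p))
        (\<lambda>p. cnj (eta_fun p))) p X Y =
      fibred_form (\<lambda>p. 2 * k / (P_fun (fst p))\<^sup>2) (\<lambda>p. \<nu> / P_fun (fst p)) (\<lambda>p. cnj (eta_fun p)) p X Y"
  proof (rule pullback_fibred_form[OF F])
    show "fst (F' X) = 1 / J\<^sup>2 * fst X" for X
      by (simp add: F'_def)
    \<comment> \<open>The left side is \<open>J\<^sup>2\<close> times the \<open>dw\<close>
      coefficient of \<open>A_form\<close> pulled back along the action. Its divisibility by
      \<open>J\<close> makes \<open>A_form\<close> scale by \<open>1 / J\<close>.\<close>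
    have key: "- cnj \<alpha> * J - (snd p + \<alpha> + - cnj \<alpha> * fst p) * cnj (g $ 1 $ 2)
        + cnj (su_act g (eta_fun p + \<alpha>)) = J * cnj (eta_fun p)"
      unfolding snd_eq_eta_fun[OF p] by (simp add: J_def su_act_def algebra_simps)
    have "snd (F' X) + cnj (su_act g (eta_fun p + \<alpha>)) * fst (F' X) =
      (snd X * J + (- cnj \<alpha> * J - (snd p + \<alpha> + - cnj \<alpha> * fst p) * cnj (g $ 1 $ 2)
        + cnj (su_act g (eta_fun p + \<alpha>))) * fst X) / J\<^sup>2" for X
      using J by (simp add: F'_def field_simps power2_eq_square)
    then have fibre: "snd (F' X) + cnj (eta_fun (disk_act a p)) * fst (F' X) =
        (snd X * J + J * cnj (eta_fun p) * fst X) / J\<^sup>2" for X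
      unfolding key a eta .
    show "snd (F' X) + cnj (eta_fun (disk_act a p)) * fst (F' X) =
        1 / J * (snd X + cnj (eta_fun p) * fst X)" for X
      unfolding fibre using J by (simp add: field_simps power2_eq_square)
    show "2 * k / (P_fun (fst (disk_act a p)))\<^sup>2 * (cmod (1 / J\<^sup>2))\<^sup>2 = 2 * k / (P_fun (fst p))\<^sup>2"
      "\<nu> / P_fun (fst (disk_act a p)) * (cmod (1 / J))\<^sup>2 = \<nu> / P_fun (fst p)"
      using J Pp unfolding a P' by (simp_all add: norm_divide norm_power power_divide field_simps)
  qed
  then show "pullback2 (disk_act a) (omega_disk k \<nu>) p X Y = omega_disk k \<nu> p X Y"
    by (simp add: omega_disk_eq)
qed

lemma invariant_pullback_FC_omega_disk:
  "invariant_under (carrier GJ0) disk_eta_act SJ_disk (pullback2 FC (omega_disk k \<nu>))"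
  unfolding invariant_under_def
proof (intro ballI allI)
  fix a p X Y
  assume "a \<in> carrier GJ0" and p: "p \<in> SJ_disk"
  then obtain g \<alpha> where a: "a = (g, \<alpha>)" and g: "g \<in> SU11"
    by (cases a) (auto simp: GJ0_simps)
  define J where "J = cnj (g $ 1 $ 2) * fst p + cnj (g $ 1 $ 1)"
  define F' where "F' X = (1 / J\<^sup>2 * fst X, su_act g (snd X))" for X :: "complex \<times> complex"
  have Pp: "0 < P_fun (fst p)"
    using p by (simp add: in_SJ_disk_iff_P_fun)
  have J: "J \<noteq> 0" and P': "P_fun (fst (disk_eta_act (g, \<alpha>) p)) = P_fun (fst p) / (cmod J)\<^sup>2"
    using P_fun_moebius[OF g Pp] by (simp_all add: J_def disk_eta_act_eq)
  have "((\<lambda>q. su_act g (snd q + \<alpha>)) has_derivative (\<lambda>X. su_act g (snd X))) (at p)"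
    unfolding su_act_def by (rule derivative_eq_intros refl)+ simp
  then have F: "(disk_eta_act a has_derivative F') (at p)"
    using J SU11_D(3)[OF g] has_derivative_Pair[OF has_derivative_moebius,
        of "g $ 1 $ 1" "cnj (g $ 1 $ 1)" "g $ 1 $ 2" "cnj (g $ 1 $ 2)" p]
    by (simp add: a J_def[symmetric] disk_eta_act_eq[abs_def] F'_def[abs_def])
  \<comment> \<open>On the fibre the action is only real-linear, so \<open>area_scale\<close> does
    not apply; its determinant \<open>|P|^2 - |Q|^2\<close> is 1.\<close>
  have "area (su_act g x) (su_act g y) =
      (g $ 1 $ 1 * cnj (g $ 1 $ 1) - g $ 1 $ 2 * cnj (g $ 1 $ 2)) * area x y" for x y
    by (simp add: area_def su_act_def algebra_simps)
  then have area: "area (su_act g x) (su_act g y) = area x y" for x y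
    by (simp add: SU11_D(3)[OF g])
  have "2 * k / (P_fun (fst (disk_eta_act (g, \<alpha>) p)))\<^sup>2 * (cmod (1 / J\<^sup>2))\<^sup>2 = 2 * k / (P_fun (fst p))\<^sup>2"
    using J Pp unfolding P' by (simp add: norm_divide norm_power power_divide field_simps)
  then have base: "complex_of_real (2 * k / (P_fun (fst (disk_eta_act (g, \<alpha>) p)))\<^sup>2) * area (fst (F' X)) (fst (F' Y)) =
      of_real (2 * k / (P_fun (fst p))\<^sup>2) * area (fst X) (fst Y)"
    unfolding F'_def fst_conv area_scale by (simp only: of_real_mult[symmetric] mult.assoc[symmetric])
  have fibre: "area (snd (F' X)) (snd (F' Y)) = area (snd X) (snd Y)"
    by (simp add: F'_def area)
  show "pullback2 (disk_eta_act a) (pullback2 FC (omega_disk k \<nu>)) p X Y = pullback2 FC (omega_disk k \<nu>) p X Y"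
    unfolding pullback2_def[of "disk_eta_act a"] frechet_derivative_eqI[OF F]
    unfolding a pullback_FC_omega_disk[OF p] pullback_FC_omega_disk[OF disk_eta_act_in_SJ_disk[OF g p]] fibred_form_def
    by (simp only: base fibre mult_zero_left add_0_right)
qed

section \<open>The Siegel--Jacobi upper half-plane\<close>

lemma in_SJ_half_plane: "p \<in> SJ_half_plane \<longleftrightarrow> 0 < Im (fst p)"
  by (cases p) (simp add: SJ_half_plane_def upper_half_plane_def)

lemma open_SJ_half_plane: "open SJ_half_plane"
  unfolding SJ_half_plane_def upper_half_plane_def
  by (intro open_Times open_UNIV open_Collect_less continuous_intros)

lemma half_plane_nonzero:
  assumes "p \<in> SJ_half_plane"
  shows "fst p + \<i> \<noteq> 0" and "fst p - cnj (fst p) \<noteq> 0" and "cnj (fst p) - fst p \<noteq> 0"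
  using assms by (auto simp: in_SJ_half_plane complex_eq_iff)

lemma FC1_eq: "FC1 p = (fst p, ((fst p + \<i>) * snd p - (fst p - \<i>) * cnj (snd p)) / (2 * \<i>))"
  by (simp add: FC1_def case_prod_unfold)

lemma FC1_inv_eq: "FC1_inv p = (fst p,
    (snd p * cnj (fst p) - cnj (snd p) * fst p + \<i> * (cnj (snd p) - snd p)) / (cnj (fst p) - fst p))"
  by (simp add: FC1_inv_def case_prod_unfold)

text \<open>With \<open>\<eta> = q + \<i> p\<close> this reads \<open>u = p v + q\<close>, the form
  in which \<open>FC1\<close> is used for the real coordinates.\<close>

lemma FC1_eq_real: "FC1 p = (fst p, of_real (Im (snd p)) * fst p + of_real (Re (snd p)))"
proof -
  have "(fst p + \<i>) * snd p - (fst p - \<i>) * cnj (snd p) =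
      2 * \<i> * (of_real (Im (snd p)) * fst p + of_real (Re (snd p)))"
    by (simp add: complex_eq_iff algebra_simps)
  then show ?thesis by (simp add: FC1_eq)
qed

text \<open>As \<open>v\<close> is not real, \<open>u\<close> is uniquely \<open>r v + s\<close>
  with real \<open>r\<close> and \<open>s\<close>; comparing imaginary parts gives
  \<open>r = Im u / Im v\<close>.\<close>

lemma FC1_inv_eq_real:
  assumes "p \<in> SJ_half_plane"
  shows "FC1_inv p = (fst p, Complex (Im (snd p) / Im (fst p) * - Re (fst p) + Re (snd p)) (Im (snd p) / Im (fst p)))"
proof -
  define r where "r = Im (snd p) / Im (fst p)"
  define s where "s = - r * Re (fst p) + Re (snd p)"
  have "snd p = of_real r * fst p + of_real s"
    using assms by (simp add: r_def s_def in_SJ_half_plane complex_eq_iff)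
  then have "snd p * cnj (fst p) - cnj (snd p) * fst p + \<i> * (cnj (snd p) - snd p) =
      (of_real s + \<i> * of_real r) * (cnj (fst p) - fst p)"
    by (simp add: algebra_simps)
  then show ?thesis
    using half_plane_nonzero(3)[OF assms]
    by (simp add: FC1_inv_eq r_def s_def Complex_eq)
qed

lemma FC1_in_SJ_half_plane: "FC1 p \<in> SJ_half_plane \<longleftrightarrow> p \<in> SJ_half_plane"
  and FC1_inv_in_SJ_half_plane: "FC1_inv p \<in> SJ_half_plane \<longleftrightarrow> p \<in> SJ_half_plane"
  by (simp_all add: in_SJ_half_plane FC1_eq FC1_inv_eq)

lemma FC1_inv_FC1: "p \<in> SJ_half_plane \<Longrightarrow> FC1_inv (FC1 p) = p"
  by (simp add: FC1_inv_eq_real FC1_in_SJ_half_plane)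
    (simp add: FC1_eq_real in_SJ_half_plane prod_eq_iff complex_eq_iff)

lemma FC1_FC1_inv: "p \<in> SJ_half_plane \<Longrightarrow> FC1 (FC1_inv p) = p"
  by (simp add: FC1_inv_eq_real FC1_eq_real)
    (simp add: in_SJ_half_plane prod_eq_iff complex_eq_iff)

lemma change_of_variables_FC1: "change_of_variables SJ_half_plane SJ_half_plane FC1 FC1_inv"
  unfolding change_of_variables_def
proof (intro conjI)
  show "smooth_on SJ_half_plane FC1"
    unfolding FC1_eq[abs_def] by (intro smooth_on_intros open_SJ_half_plane) simp
  show "smooth_on SJ_half_plane FC1_inv"
    unfolding FC1_inv_eq[abs_def]
    by (intro smooth_on_intros open_SJ_half_plane half_plane_nonzero)
qed (auto simp: FC1_in_SJ_half_plane FC1_inv_in_SJ_half_plane FC1_FC1_inv FC1_inv_FC1)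

section \<open>The partial Cayley transform\<close>

lemma Phi_eq: "Phi p = ((fst p - \<i>) / (fst p + \<i>), 2 * \<i> * snd p / (fst p + \<i>))"
  by (simp add: Phi_def case_prod_unfold)

lemma Phi_inv_eq: "Phi_inv p = (\<i> * (1 + fst p) / (1 - fst p), snd p / (1 - fst p))"
  by (simp add: Phi_inv_def case_prod_unfold)

text \<open>A point of the upper half-plane is closer to \<open>\<i>\<close> than to
  \<open>- \<i>\<close>.\<close>

lemma Phi_in_SJ_disk:
  assumes "p \<in> SJ_half_plane"
  shows "Phi p \<in> SJ_disk"
proof -
  have "(cmod (fst p - \<i>))\<^sup>2 < (cmod (fst p + \<i>))\<^sup>2"
    using assms unfolding in_SJ_half_plane cmod_power2 by (simp add: power2_eq_square algebra_simps)
  then have "cmod (fst p - \<i>) < cmod (fst p + \<i>)"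
    by (rule power2_less_imp_less) simp
  then show ?thesis
    using half_plane_nonzero[OF assms] by (simp add: in_SJ_disk Phi_eq norm_divide)
qed

lemma disk_nonzero: "p \<in> SJ_disk \<Longrightarrow> 1 - fst p \<noteq> 0"
  by (auto simp: in_SJ_disk)

text \<open>Extending the fraction by the conjugate denominator gives
  \<open>Im v = P_fun w / |1 - w|^2\<close>.\<close>

lemma Phi_inv_in_SJ_half_plane:
  assumes "p \<in> SJ_disk"
  shows "Phi_inv p \<in> SJ_half_plane"
proof -
  have nz: "1 - fst p \<noteq> 0"
    using assms by (rule disk_nonzero)
  have "\<i> * (1 + fst p) / (1 - fst p) = \<i> * (1 + fst p) * cnj (1 - fst p) / of_real ((cmod (1 - fst p))\<^sup>2)"
    using nz unfolding complex_norm_square by simp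
  then have "Im (fst (Phi_inv p)) = Im (\<i> * (1 + fst p) * cnj (1 - fst p)) / (cmod (1 - fst p))\<^sup>2"
    by (simp only: Phi_inv_eq fst_conv Im_divide_of_real)
  also have "Im (\<i> * (1 + fst p) * cnj (1 - fst p)) = P_fun (fst p)"
    unfolding P_fun_def cmod_power2 by (simp add: power2_eq_square algebra_simps)
  finally show ?thesis
    using assms nz by (simp add: in_SJ_half_plane in_SJ_disk_iff_P_fun)
qed

lemma change_of_variables_Phi: "change_of_variables SJ_half_plane SJ_disk Phi Phi_inv"
  unfolding change_of_variables_def
proof (intro conjI ballI)
  show "smooth_on SJ_half_plane Phi"
    unfolding Phi_eq[abs_def]
    by (intro smooth_on_intros open_SJ_half_plane half_plane_nonzero)
  show "smooth_on SJ_disk Phi_inv"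
    unfolding Phi_inv_eq[abs_def]
    by (intro smooth_on_intros open_SJ_disk disk_nonzero)
next
  fix p assume "p \<in> SJ_half_plane"
  note nz = half_plane_nonzero(1)[OF this]
  have "1 - (fst p - \<i>) / (fst p + \<i>) = 2 * \<i> / (fst p + \<i>)"
    "1 + (fst p - \<i>) / (fst p + \<i>) = 2 * fst p / (fst p + \<i>)"
    using nz by (simp_all add: field_simps)
  then show "Phi_inv (Phi p) = p"
    using nz by (simp add: Phi_eq Phi_inv_eq prod_eq_iff)
next
  fix p assume "p \<in> SJ_disk"
  note nz = disk_nonzero[OF this]
  have "\<i> * (1 + fst p) / (1 - fst p) - \<i> = 2 * \<i> * fst p / (1 - fst p)"
    "\<i> * (1 + fst p) / (1 - fst p) + \<i> = 2 * \<i> / (1 - fst p)"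
    using nz by (simp_all add: field_simps)
  then show "Phi (Phi_inv p) = p"
    using nz by (simp add: Phi_eq Phi_inv_eq prod_eq_iff)
qed (auto simp: Phi_in_SJ_disk Phi_inv_in_SJ_half_plane)

text \<open>The Cayley transform carries \<open>FC1\<close> to \<open>FC\<close> with
  \<open>\<eta>\<close> unchanged, so disk and half-plane share the same fibre coordinate.\<close>

lemma Phi_FC1:
  assumes "p \<in> SJ_half_plane"
  shows "Phi (FC1 p) = FC (fst (Phi p), snd p)"
  using half_plane_nonzero(1)[OF assms] by (simp add: Phi_eq FC1_eq FC_eq diff_divide_distrib left_diff_distrib)

lemma eta_fun_Phi:
  assumes p: "p \<in> SJ_half_plane"
  shows "eta_fun (Phi p) = snd (FC1_inv p)"
proof -
  have "fst (Phi (FC1_inv p)) = fst (Phi p)"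
    by (simp add: Phi_eq FC1_inv_eq)
  then have "Phi p = FC (fst (Phi p), snd (FC1_inv p))"
    using Phi_FC1[of "FC1_inv p"] p by (simp add: FC1_FC1_inv FC1_inv_in_SJ_half_plane)
  then show ?thesis
    using eta_fun_FC[of "(fst (Phi p), snd (FC1_inv p))"] Phi_in_SJ_disk[OF p]
    by (simp add: in_SJ_disk)
qed

lemma B_form_eq: "B_form p X = snd X + - of_real (Im (snd p) / Im (fst p)) * fst X"
proof -
  have "(snd p - cnj (snd p)) / (fst p - cnj (fst p)) = of_real (Im (snd p) / Im (fst p))"
    by (simp add: complex_diff_cnj)
  then show ?thesis
    by (simp add: B_form_def ed_fst ed_snd)
qed

lemma pullback_Phi_A_form:
  assumes p: "p \<in> SJ_half_plane"
  shows "pullback1 Phi A_form p X = 2 * \<i> / (fst p + \<i>) * B_form p X"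
proof -
  define v where "v = fst p"
  define r s where "r = complex_of_real (Im (snd p) / Im v)"
    and "s = complex_of_real (Im (snd p) / Im v * - Re v + Re (snd p))"
  have nz: "v + \<i> \<noteq> 0"
    using half_plane_nonzero[OF p] by (simp add: v_def)
  have u: "snd p = r * v + s"
    using p by (simp add: r_def s_def v_def in_SJ_half_plane complex_eq_iff)
  have eta: "cnj (eta_fun (Phi p)) = s - \<i> * r"
    by (simp add: eta_fun_Phi[OF p] FC1_inv_eq_real[OF p] r_def s_def v_def complex_eq_iff)
  have "((\<lambda>q. (1 * fst q + - \<i>) / (1 * fst q + \<i>)) has_derivative
      (\<lambda>X. 2 * \<i> * fst X / (v + \<i>)\<^sup>2)) (at p)"
    by (rule has_derivative_eq_rhs[OF has_derivative_divide'])
      (use nz in \<open>auto intro!: derivative_eq_intros simp: fun_eq_iff v_def power2_eq_square algebra_simps\<close>)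
  moreover have "((\<lambda>q. 2 * \<i> * snd q / (fst q + \<i>)) has_derivative
      (\<lambda>X. 2 * \<i> * snd X / (v + \<i>) - 2 * \<i> * snd p * fst X / (v + \<i>)\<^sup>2)) (at p)"
    by (rule has_derivative_eq_rhs[OF has_derivative_divide'])
      (use nz in \<open>auto intro!: derivative_eq_intros simp: fun_eq_iff v_def power2_eq_square diff_divide_distrib\<close>)
  ultimately have "(Phi has_derivative (\<lambda>X. (2 * \<i> * fst X / (v + \<i>)\<^sup>2,
      2 * \<i> * snd X / (v + \<i>) - 2 * \<i> * snd p * fst X / (v + \<i>)\<^sup>2))) (at p)"
    using has_derivative_Pair by (fastforce simp: Phi_eq[abs_def])
  then have "pullback1 Phi A_form p X = 2 * \<i> * snd X / (v + \<i>) - 2 * \<i> * (r * v + s) * fst X / (v + \<i>)\<^sup>2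
      + (s - \<i> * r) * (2 * \<i> * fst X / (v + \<i>)\<^sup>2)"
    by (simp add: pullback1_def frechet_derivative_eqI A_form_eq eta u)
  \<comment> \<open>In the \<open>fst X\<close> coefficient \<open>s\<close> cancels and
    \<open>- 2 \<i> r (v + \<i>)\<close> remains over \<open>(v + \<i>)\<^sup>2\<close>.\<close>
  also have "\<dots> = 2 * \<i> / (v + \<i>) * (snd X + - r * fst X)"
    using nz by (simp add: divide_simps power2_eq_square) (simp add: algebra_simps)
  finally show ?thesis
    by (simp add: B_form_eq r_def v_def)
qed

section \<open>The Kaehler form of Berndt and Kaehler\<close>

lemma omega_half_plane_eq:
  "omega_half_plane k \<nu> = fibred_form (\<lambda>p. k / (2 * (Im (fst p))\<^sup>2)) (\<lambda>p. \<nu> / Im (fst p))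
     (\<lambda>p. - of_real (Im (snd p) / Im (fst p)))"
proof (intro ext)
  fix p X Y :: "complex \<times> complex"
  have d: "cnj (fst p) - fst p = - (2 * \<i> * of_real (Im (fst p)))"
    by (simp add: complex_eq_iff)
  have "- (complex_of_real (2 * k) / (cnj (fst p) - fst p)\<^sup>2) = of_real (k / (2 * (Im (fst p))\<^sup>2))"
    unfolding d by (simp add: power_mult_distrib)
  moreover have "complex_of_real (2 * \<nu>) / (\<i> * (cnj (fst p) - fst p)) = of_real (\<nu> / Im (fst p))"
    unfolding d by simp
  ultimately show "omega_half_plane k \<nu> p X Y = fibred_form (\<lambda>p. k / (2 * (Im (fst p))\<^sup>2))
      (\<lambda>p. \<nu> / Im (fst p)) (\<lambda>p. - of_real (Im (snd p) / Im (fst p))) p X Y"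
    by (simp only: omega_half_plane_def fibred_form_def wedge_def cnj1_def ed_fst B_form_eq area_def)
qed

text \<open>Split into the complex-linear and antilinear parts that \<open>ed2_fibred_form\<close>
  asks for.\<close>

lemma has_derivative_Im:
  "bounded_linear L \<Longrightarrow> ((\<lambda>q. complex_of_real (Im (L q))) has_derivative
    (\<lambda>X. (L X - cnj (L X)) / (2 * \<i>))) (at p)"
  by (rule has_derivative_eq_rhs[OF bounded_linear_imp_has_derivative[OF bounded_linear_compose[OF
            bounded_linear_of_real bounded_linear_compose[OF bounded_linear_Im]]]])
    (simp_all add: fun_eq_iff complex_eq_iff)

text \<open>With \<open>y = Im v\<close>, the \<open>du\<close> coefficient of the derivative of
  \<open>- Im u / y\<close> is \<open>\<i> / (2 y)\<close>, which is also the logarithmic derivative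
  of \<open>\<nu> / y\<close> along \<open>dv\<close>.\<close>

lemma ed2_omega_half_plane:
  assumes p: "p \<in> SJ_half_plane"
  shows "ed2 (omega_half_plane k \<nu>) p X Y Z = 0"
proof (rule ed2_fibred_form[OF open_SJ_half_plane p])
  define y where "y = complex_of_real (Im (fst p))"
  define r where "r = complex_of_real (Im (snd p) / Im (fst p))"
  have nz: "y \<noteq> 0"
    using p by (simp add: y_def in_SJ_half_plane)
  have cnj_y: "cnj y = y" and cnj_r: "cnj r = r"
    by (simp_all add: y_def r_def)
  note D = has_derivative_Im[OF bounded_linear_fst, of p] has_derivative_Im[OF bounded_linear_snd, of p]
  show "((\<lambda>q. complex_of_real (\<nu> / Im (fst q))) has_derivative
      (\<lambda>X. of_real (\<nu> / Im (fst p)) * (\<i> / (2 * y) * fst X + cnj (\<i> / (2 * y)) * cnj (fst X)))) (at p)"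
    unfolding of_real_divide
    by (rule has_derivative_eq_rhs[OF has_derivative_divide'[OF has_derivative_const D(1)]])
      (use nz in \<open>simp_all add: fun_eq_iff y_def[symmetric] cnj_y field_simps\<close>)
  show "((\<lambda>q. complex_of_real (k / (2 * (Im (fst q))\<^sup>2))) has_derivative
      (\<lambda>X. \<i> * k / (2 * y ^ 3) * fst X + cnj (\<i> * k / (2 * y ^ 3)) * cnj (fst X))) (at p)"
    unfolding of_real_divide of_real_mult of_real_power unfolding power2_eq_square
    by (rule has_derivative_eq_rhs[OF has_derivative_divide'[OF has_derivative_const
            has_derivative_mult[OF has_derivative_const has_derivative_mult[OF D(1) D(1)]]]])
      (use nz in \<open>simp_all add: fun_eq_iff y_def[symmetric] cnj_y field_simps power3_eq_cube\<close>)
  have u: "complex_of_real (Im (snd p)) = r * y"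
    using nz by (simp add: r_def y_def)
  have "((\<lambda>q. - (complex_of_real (Im (snd q)) / complex_of_real (Im (fst q)))) has_derivative
      (\<lambda>X. - (((snd X - cnj (snd X)) / (2 * \<i>) * y - r * y * ((fst X - cnj (fst X)) / (2 * \<i>))) / (y * y)))) (at p)"
    using has_derivative_minus[OF has_derivative_divide'[OF D(2,1)]] nz by (simp add: u y_def[symmetric])
  moreover have "- (((snd X - cnj (snd X)) / (2 * \<i>) * y - r * y * ((fst X - cnj (fst X)) / (2 * \<i>))) / (y * y))
      = - \<i> * r / (2 * y) * fst X + \<i> / (2 * y) * snd X
        + - \<i> / (2 * y) * (cnj (snd X) + cnj (- r) * cnj (fst X))" for X
    using nz by (simp add: cnj_r field_simps)
  ultimately show "((\<lambda>q. - complex_of_real (Im (snd q) / Im (fst q))) has_derivative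
      (\<lambda>X. - \<i> * r / (2 * y) * fst X + \<i> / (2 * y) * snd X
        + - \<i> / (2 * y) * (cnj (snd X) + cnj (- of_real (Im (snd p) / Im (fst p))) * cnj (fst X)))) (at p)"
    by (simp add: r_def)
qed (rule omega_half_plane_eq[THEN fun_cong, THEN fun_cong, THEN fun_cong])

lemma is_kahler_omega_half_plane:
  assumes "0 < k" and "0 < \<nu>"
  shows "is_kahler SJ_half_plane (omega_half_plane k \<nu>)"
  unfolding is_kahler_def
proof (rule exI, rule kahler_with_fibred_form)
  show "omega_half_plane k \<nu> p X Y = fibred_form (\<lambda>p. k / (2 * (Im (fst p))\<^sup>2)) (\<lambda>p. \<nu> / Im (fst p))
      (\<lambda>p. - of_real (Im (snd p) / Im (fst p))) p X Y" for p X Y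
    by (simp add: omega_half_plane_eq)
qed (use assms in \<open>auto simp: in_SJ_half_plane simp del: of_real_divide
    intro!: smooth_on_intros open_SJ_half_plane ed2_omega_half_plane\<close>)

section \<open>The real Jacobi group and its action on the half-plane\<close>

lemma GJR0_simps:
  "carrier GJR0 = {M. det M = 1} \<times> UNIV" "\<one>\<^bsub>GJR0\<^esub> = (mat 1, 0)"
  "(M, \<alpha>) \<otimes>\<^bsub>GJR0\<^esub> (N, \<beta>) = (M ** N, of_row (row_of \<alpha> v* N + row_of \<beta>))"
  by (simp_all add: GJR0_def)

lemma row_of_of_row: "row_of (of_row X) = X"
  by (simp add: row_of_def of_row_def vec_eq_iff forall_2)

lemma of_row_row_of: "of_row (row_of \<alpha>) = \<alpha>"
  by (simp add: row_of_def of_row_def)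

lemma row_of_0: "row_of 0 = 0"
  by (simp add: row_of_def vec_eq_iff forall_2)

lemma group_GJR0: "group GJR0"
proof (rule groupI)
  fix a b c
  assume "a \<in> carrier GJR0" "b \<in> carrier GJR0" "c \<in> carrier GJR0"
  show "a \<otimes>\<^bsub>GJR0\<^esub> b \<otimes>\<^bsub>GJR0\<^esub> c = a \<otimes>\<^bsub>GJR0\<^esub> (b \<otimes>\<^bsub>GJR0\<^esub> c)"
    by (cases a; cases b; cases c)
      (simp add: GJR0_simps row_of_of_row matrix_mul_assoc vector_matrix_mul_assoc
        vector_matrix_left_distrib add.assoc)
next
  fix a
  assume "a \<in> carrier GJR0"
  then obtain M \<alpha> where a: "a = (M, \<alpha>)" and M: "det M = 1"
    by (cases a) (auto simp: GJR0_simps)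
  then obtain N where N: "N ** M = mat 1"
    using invertible_det_nz[of M] by (auto simp: invertible_def)
  then have "det N = 1"
    using det_mul[of N M] M by simp
  \<comment> \<open>For the row \<open>X\<close> of \<open>\<alpha>\<close>, the translation row
    \<open>- X N\<close> of the left inverse becomes \<open>- X\<close> after multiplication by
    \<open>M\<close> and cancels \<open>X\<close>.\<close>
  then have "(N, of_row (- row_of \<alpha> v* N)) \<in> carrier GJR0"
    by (simp add: GJR0_simps)
  moreover have "(N, of_row (- row_of \<alpha> v* N)) \<otimes>\<^bsub>GJR0\<^esub> a = \<one>\<^bsub>GJR0\<^esub>"
    by (simp add: a GJR0_simps row_of_of_row vector_matrix_mul_assoc N) (simp add: of_row_def complex_eq_iff)
  ultimately show "\<exists>b\<in>carrier GJR0. b \<otimes>\<^bsub>GJR0\<^esub> a = \<one>\<^bsub>GJR0\<^esub>"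
    by blast
qed (auto simp: GJR0_simps det_mul row_of_of_row of_row_row_of row_of_0)

lemma half_plane_act_eq:
  "half_plane_act (M, \<alpha>) p =
    ((of_real (M $ 1 $ 1) * fst p + of_real (M $ 1 $ 2)) / (of_real (M $ 2 $ 1) * fst p + of_real (M $ 2 $ 2)),
     (snd p + of_real (Re \<alpha>) + of_real (Im \<alpha>) * fst p) / (of_real (M $ 2 $ 1) * fst p + of_real (M $ 2 $ 2)))"
  by (simp add: half_plane_act_def Let_def case_prod_unfold algebra_simps)

lemma det_2_eq_1: "det M = 1 \<Longrightarrow> M $ 1 $ 1 * M $ 2 $ 2 - M $ 1 $ 2 * M $ 2 $ 1 = (1::real)" for M :: "real^2^2"
  by (simp add: det_2)

text \<open>With numerator \<open>N\<close>, the imaginary part of \<open>N cnj J\<close> is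
  \<open>det M\<close> times \<open>Im v\<close>; a vanishing \<open>J\<close> would force a zero
  second row of \<open>M\<close>.\<close>

lemma half_plane_denominator:
  fixes M :: "real^2^2"
  assumes M: "det M = 1" and v: "0 < Im v"
  defines "J \<equiv> complex_of_real (M $ 2 $ 1) * v + complex_of_real (M $ 2 $ 2)"
  shows "J \<noteq> 0" and "Im ((of_real (M $ 1 $ 1) * v + of_real (M $ 1 $ 2)) / J) = Im v / (cmod J)\<^sup>2"
proof -
  show J: "J \<noteq> 0"
  proof
    assume "J = 0"
    then have "M $ 2 $ 1 = 0" "M $ 2 $ 2 = 0"
      using v by (auto simp: J_def complex_eq_iff)
    then show False
      using M by (simp add: det_2)
  qed
  define N where "N = complex_of_real (M $ 1 $ 1) * v + of_real (M $ 1 $ 2)"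
  have "N / J = N * cnj J / of_real ((cmod J)\<^sup>2)"
    using J unfolding complex_norm_square by simp
  then have "Im (N / J) = Im (N * cnj J) / (cmod J)\<^sup>2"
    by (simp only: Im_divide_of_real)
  also have "Im (N * cnj J) = (M $ 1 $ 1 * M $ 2 $ 2 - M $ 1 $ 2 * M $ 2 $ 1) * Im v"
    by (simp add: N_def J_def algebra_simps)
  finally show "Im ((of_real (M $ 1 $ 1) * v + of_real (M $ 1 $ 2)) / J) = Im v / (cmod J)\<^sup>2"
    by (simp add: det_2_eq_1[OF M] N_def)
qed

lemma half_plane_act_in_SJ_half_plane:
  assumes "det M = 1" and "p \<in> SJ_half_plane"
  shows "half_plane_act (M, \<alpha>) p \<in> SJ_half_plane"
  using half_plane_denominator[OF assms(1), of "fst p"] assms(2)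
  by (simp add: in_SJ_half_plane half_plane_act_eq)

lemma half_plane_act_mult:
  assumes N: "det N = 1" and p: "p \<in> SJ_half_plane"
  shows "half_plane_act ((M, \<alpha>) \<otimes>\<^bsub>GJR0\<^esub> (N, \<beta>)) p = half_plane_act (M, \<alpha>) (half_plane_act (N, \<beta>) p)"
proof -
  define v where "v = fst p"
  define J where "J = complex_of_real (N $ 2 $ 1) * v + of_real (N $ 2 $ 2)"
  define v' where "v' = (of_real (N $ 1 $ 1) * v + of_real (N $ 1 $ 2)) / J"
  define u' where "u' = (snd p + of_real (Re \<beta>) + of_real (Im \<beta>) * v) / J"
  have J: "J \<noteq> 0"
    using half_plane_denominator(1)[OF N, of v] p by (simp add: J_def v_def in_SJ_half_plane)
  have v': "v' * J = of_real (N $ 1 $ 1) * v + of_real (N $ 1 $ 2)"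
    and u': "u' * J = snd p + of_real (Re \<beta>) + of_real (Im \<beta>) * v"
    using J by (simp_all add: v'_def u'_def)
  have lin: "of_real ((M ** N) $ i $ 1) * v + of_real ((M ** N) $ i $ 2) =
      (of_real (M $ i $ 1) * v' + of_real (M $ i $ 2)) * J" for i
    unfolding distrib_right mult.assoc v'
    by (simp add: J_def matrix_matrix_mult_def sum_2 algebra_simps)
  \<comment> \<open>Here the row law enters: composing the translations yields the row of
    \<open>\<alpha>\<close> times \<open>N\<close> plus the row of \<open>\<beta>\<close>, up to the
    common factor \<open>J\<close>.\<close>
  have "snd p + of_real (Re (of_row (row_of \<alpha> v* N + row_of \<beta>)))
      + of_real (Im (of_row (row_of \<alpha> v* N + row_of \<beta>))) * v =
      (u' + of_real (Re \<alpha>) + of_real (Im \<alpha>) * v') * J"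
    unfolding distrib_right mult.assoc v' u'
    by (simp add: J_def of_row_def row_of_def vector_matrix_mult_def sum_2 algebra_simps)
  with J show ?thesis
    by (simp add: half_plane_act_eq GJR0_simps v_def[symmetric] J_def[symmetric] v'_def[symmetric]
        u'_def[symmetric] lin)
qed

lemma group_action_half_plane_act:
  "group_action GJR0 SJ_half_plane (\<lambda>g. restrict (half_plane_act g) SJ_half_plane)"
proof (rule group_actionI[OF group_GJR0])
  fix p
  show "half_plane_act \<one>\<^bsub>GJR0\<^esub> p = p"
    by (simp add: GJR0_simps half_plane_act_eq mat_def)
qed (auto simp: GJR0_simps(1) half_plane_act_in_SJ_half_plane half_plane_act_mult)

text \<open>
  Writing \<open>u = r v + s\<close> with real \<open>r, s\<close>, the image point has the slope \<open>r'\<close> below, since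
  \<open>(r', s') M = (r + n, s + m)\<close>.
\<close>

lemma invariant_omega_half_plane:
  "invariant_under (carrier GJR0) half_plane_act SJ_half_plane (omega_half_plane k \<nu>)"
  unfolding invariant_under_def
proof (intro ballI allI)
  fix A p X Y
  assume "A \<in> carrier GJR0" and p: "p \<in> SJ_half_plane"
  then obtain M \<alpha> where A: "A = (M, \<alpha>)" and M: "det M = 1"
    by (cases A) (auto simp: GJR0_simps)
  define v where "v = fst p"
  define a b c d m n where "a = complex_of_real (M $ 1 $ 1)" and "b = complex_of_real (M $ 1 $ 2)"
    and "c = complex_of_real (M $ 2 $ 1)" and "d = complex_of_real (M $ 2 $ 2)"
    and "m = complex_of_real (Re \<alpha>)" and "n = complex_of_real (Im \<alpha>)"
  note defs = a_def b_def c_def d_def m_def n_def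
  define J where "J = c * v + d"
  define r s where "r = complex_of_real (Im (snd p) / Im v)"
    and "s = complex_of_real (Im (snd p) / Im v * - Re v + Re (snd p))"
  define r' where "r' = (r + n) * d - (s + m) * c"
  define F' where "F' X = (1 / J\<^sup>2 * fst X, (snd X + n * fst X) / J - (snd p + m + n * v) * c * fst X / J\<^sup>2)"
    for X :: "complex \<times> complex"
  have v: "0 < Im v"
    using p by (simp add: v_def in_SJ_half_plane)
  have J: "J \<noteq> 0" and Im': "Im (fst (half_plane_act A p)) = Im v / (cmod J)\<^sup>2"
    using half_plane_denominator[OF M v] by (simp_all add: J_def defs A half_plane_act_eq v_def[symmetric])
  have det: "a * d - b * c = 1"
    using arg_cong[OF det_2_eq_1[OF M], of complex_of_real] by (simp add: defs)
  have u: "snd p = r * v + s"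
    using v by (simp add: r_def s_def complex_eq_iff)
  have act: "half_plane_act A q = ((a * fst q + b) / (c * fst q + d), (snd q + m + n * fst q) / (c * fst q + d))" for q
    by (simp add: A half_plane_act_eq defs)
  have F: "(half_plane_act A has_derivative F') (at p)"
    using J has_derivative_Pair[OF has_derivative_moebius[OF det] has_derivative_affine_over_affine, of p c d m n]
    by (simp add: act[abs_def] F'_def[abs_def] J_def v_def)
  have r': "of_real (Im (snd (half_plane_act A p)) / Im (fst (half_plane_act A p))) = r'"
  proof -
    \<comment> \<open>With \<open>r'\<close> this is the second entry of
      \<open>(r + n, s + m)\<close> times the inverse of \<open>M\<close>, so
      \<open>u' = r' v' + s'\<close> at the image point.\<close>
    define s' where "s' = (s + m) * a - (r + n) * b"
    have "r' * (a * v + b) + s' * (c * v + d) = snd p + m + n * v"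
      using det unfolding u r'_def s'_def by algebra
    then have "snd (half_plane_act A p) = r' * fst (half_plane_act A p) + s'"
      using J by (simp add: act v_def[symmetric] J_def field_simps)
    moreover have real: "Im r' = 0" "Im s' = 0"
      by (simp_all add: r'_def s'_def r_def s_def defs)
    ultimately have "Im (snd (half_plane_act A p)) = Re r' * Im (fst (half_plane_act A p))"
      by simp
    then show ?thesis
      using Im' v J real by (simp add: complex_eq_iff)
  qed
  have "pullback2 (half_plane_act A) (fibred_form (\<lambda>p. k / (2 * (Im (fst p))\<^sup>2)) (\<lambda>p. \<nu> / Im (fst p))
        (\<lambda>p. - of_real (Im (snd p) / Im (fst p)))) p X Y =
      fibred_form (\<lambda>p. k / (2 * (Im (fst p))\<^sup>2)) (\<lambda>p. \<nu> / Im (fst p))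
        (\<lambda>p. - of_real (Im (snd p) / Im (fst p))) p X Y"
  proof (rule pullback_fibred_form[OF F])
    show "fst (F' X) = 1 / J\<^sup>2 * fst X" for X
      by (simp add: F'_def)
    \<comment> \<open>\<open>J\<^sup>2\<close> times the \<open>dv\<close> coefficient of
      \<open>B_form\<close> pulled back along the action; the factor \<open>J\<close> leaves a
      scaling by \<open>1 / J\<close>.\<close>
    have key: "n * J - (r * v + s + m + n * v) * c - r' = - r * J"
      unfolding J_def r'_def by algebra
    have fibre: "snd (F' X) + - r' * fst (F' X) =
        (snd X * J + (n * J - (r * v + s + m + n * v) * c - r') * fst X) / J\<^sup>2" for X
      using J by (simp add: F'_def u) (simp add: field_simps power2_eq_square)
    show "snd (F' X) + - of_real (Im (snd (half_plane_act A p)) / Im (fst (half_plane_act A p))) * fst (F' X) =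
        1 / J * (snd X + - of_real (Im (snd p) / Im (fst p)) * fst X)" for X
      unfolding r' fibre key r_def[symmetric] v_def[symmetric] using J by (simp add: field_simps power2_eq_square)
    show "k / (2 * (Im (fst (half_plane_act A p)))\<^sup>2) * (cmod (1 / J\<^sup>2))\<^sup>2 = k / (2 * (Im (fst p))\<^sup>2)"
      "\<nu> / Im (fst (half_plane_act A p)) * (cmod (1 / J))\<^sup>2 = \<nu> / Im (fst p)"
      using J v unfolding Im' v_def[symmetric]
      by (simp_all add: norm_divide norm_power power_divide field_simps)
  qed
  then show "pullback2 (half_plane_act A) (omega_half_plane k \<nu>) p X Y = omega_half_plane k \<nu> p X Y"
    by (simp add: omega_half_plane_eq)
qed

section \<open>Real coordinates\<close>

lemma has_derivative_Complex:
  assumes "(f has_derivative f') (at c)" and "(g has_derivative g') (at c)"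
  shows "((\<lambda>c. Complex (f c) (g c)) has_derivative (\<lambda>X. Complex (f' X) (g' X))) (at c)"
  unfolding Complex_eq using assms by (auto intro!: derivative_eq_intros)

lemma has_derivative_xy:
  "((\<lambda>(x, y, s, t). Complex x y) has_derivative (\<lambda>X. Complex (fst X) (fst (snd X)))) (at c)"
  for c :: "real \<times> real \<times> real \<times> real"
  unfolding case_prod_unfold by (intro has_derivative_Complex derivative_intros)

lemma has_derivative_st:
  "((\<lambda>(x, y, s, t). Complex s t) has_derivative
    (\<lambda>X. Complex (fst (snd (snd X))) (snd (snd (snd X))))) (at c)"
  for c :: "real \<times> real \<times> real \<times> real"
  unfolding case_prod_unfold by (intro has_derivative_Complex derivative_intros)

lemma has_derivative_s:
  "((\<lambda>(x, y, s, t). complex_of_real s) has_derivative (\<lambda>X. of_real (fst (snd (snd X))))) (at c)"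
  for c :: "real \<times> real \<times> real \<times> real"
  unfolding case_prod_unfold by (intro derivative_intros)

lemma has_derivative_t:
  "((\<lambda>(x, y, s, t). complex_of_real t) has_derivative (\<lambda>X. of_real (snd (snd (snd X))))) (at c)"
  for c :: "real \<times> real \<times> real \<times> real"
  unfolding case_prod_unfold by (intro derivative_intros)

lemma has_derivative_pv_plus_q:
  "((\<lambda>(x, y, p, q). of_real p * Complex x y + of_real q) has_derivative
    (\<lambda>X. of_real p * Complex (fst X) (fst (snd X)) + Complex x y * of_real (fst (snd (snd X)))
      + of_real (snd (snd (snd X))))) (at (x, y, p, q))"
  using has_derivative_add[OF has_derivative_mult[OF has_derivative_s has_derivative_xy] has_derivative_t,
      of "(x, y, p, q)"]
  by (simp add: case_prod_unfold mult.commute)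

lemma has_derivative_psi_v_plus_chi:
  "((\<lambda>(x, y, chi, psi). of_real psi * Complex x y + of_real chi) has_derivative
    (\<lambda>X. of_real psi * Complex (fst X) (fst (snd X)) + Complex x y * of_real (snd (snd (snd X)))
      + of_real (fst (snd (snd X))))) (at (x, y, chi, psi))"
  using has_derivative_add[OF has_derivative_mult[OF has_derivative_t has_derivative_xy] has_derivative_s,
      of "(x, y, chi, psi)"]
  by (simp add: case_prod_unfold mult.commute)

text \<open>One formula for all three real coordinate systems: only the slope
  \<open>Im u / Im v\<close> has to be evaluated in each of them.\<close>

lemma pullback_B_form:
  assumes "(f has_derivative f') (at c)" and "(g has_derivative g') (at c)"
    and F: "\<And>c. F c = (f c, g c)"
  shows "pullback1 F B_form c X = g' X - of_real (Im (g c) / Im (f c)) * f' X"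
proof -
  have "F = (\<lambda>c. (f c, g c))"
    using F by auto
  then show ?thesis
    by (simp add: pullback1_def frechet_derivative_eqI[OF has_derivative_Pair[OF assms(1,2)]] B_form_eq)
qed

lemma vu_of_pq_eq: "vu_of_pq c =
    ((\<lambda>(x, y, s, t). Complex x y) c, (\<lambda>(x, y, p, q). of_real p * Complex x y + of_real q) c)"
  by (simp add: vu_of_pq_def case_prod_unfold)

lemma vu_of_chi_psi_eq: "vu_of_chi_psi c =
    ((\<lambda>(x, y, s, t). Complex x y) c, (\<lambda>(x, y, chi, psi). of_real psi * Complex x y + of_real chi) c)"
  by (simp add: vu_of_chi_psi_def FC1_eq_real case_prod_unfold)

lemma vu_of_xi_rho_eq: "vu_of_xi_rho c = ((\<lambda>(x, y, s, t). Complex x y) c, (\<lambda>(x, y, s, t). Complex s t) c)"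
  by (simp add: vu_of_xi_rho_def case_prod_unfold)

lemma pullback_vu_of_pq_B_form:
  assumes "0 < y"
  shows "pullback1 vu_of_pq B_form (x, y, p, q) X =
      ed (\<lambda>(x, y, p, q). of_real p * Complex x y + of_real q) (x, y, p, q) X
      - of_real p * ed (\<lambda>(x, y, p, q). Complex x y) (x, y, p, q) X"
  using assms
  by (simp add: pullback_B_form[OF has_derivative_xy has_derivative_pv_plus_q vu_of_pq_eq]
      ed_eqI[OF has_derivative_xy] ed_eqI[OF has_derivative_pv_plus_q])

text \<open>The product rule for \<open>u = p v + q\<close>: the term \<open>p dv\<close>
  cancels.\<close>

lemma ed_pv_plus_q:
  "ed (\<lambda>(x, y, p, q). of_real p * Complex x y + of_real q) (x, y, p, q) X
      - of_real p * ed (\<lambda>(x, y, p, q). Complex x y) (x, y, p, q) X =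
    Complex x y * ed (\<lambda>(x, y, p, q). of_real p) (x, y, p, q) X + ed (\<lambda>(x, y, p, q). of_real q) (x, y, p, q) X"
  by (simp add: ed_eqI[OF has_derivative_xy] ed_eqI[OF has_derivative_pv_plus_q]
      ed_eqI[OF has_derivative_s] ed_eqI[OF has_derivative_t])

lemma pullback_vu_of_chi_psi_B_form:
  assumes "0 < y"
  shows "pullback1 vu_of_chi_psi B_form (x, y, chi, psi) X =
    of_real x * ed (\<lambda>(x, y, chi, psi). of_real psi) (x, y, chi, psi) X
    + ed (\<lambda>(x, y, chi, psi). of_real chi) (x, y, chi, psi) X
    + \<i> * of_real y * ed (\<lambda>(x, y, chi, psi). of_real psi) (x, y, chi, psi) X"
  using assms
  by (simp add: pullback_B_form[OF has_derivative_xy has_derivative_psi_v_plus_chi vu_of_chi_psi_eq]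
      ed_eqI[OF has_derivative_s] ed_eqI[OF has_derivative_t] Complex_eq algebra_simps)

lemma pullback_vu_of_xi_rho_B_form:
  "pullback1 vu_of_xi_rho B_form (x, y, \<xi>, \<rho>) X =
    ed (\<lambda>(x, y, \<xi>, \<rho>). Complex \<xi> \<rho>) (x, y, \<xi>, \<rho>) X
    - of_real (\<rho> / y) * ed (\<lambda>(x, y, \<xi>, \<rho>). Complex x y) (x, y, \<xi>, \<rho>) X"
  by (simp add: pullback_B_form[OF has_derivative_xy has_derivative_st vu_of_xi_rho_eq]
      ed_eqI[OF has_derivative_xy] ed_eqI[OF has_derivative_st])

text \<open>The right side of the relation is \<open>2 \<i>\<close> times
  \<open>\<psi> v + \<chi>\<close>, which leaves only a comparison of coefficients in the coordinate
  statements.\<close>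

lemma FC1_relation_iff:
  assumes "0 < y"
  shows "2 * \<i> * u = (Complex x y + \<i>) * Complex chi psi - (Complex x y - \<i>) * cnj (Complex chi psi) \<longleftrightarrow>
    u = of_real psi * Complex x y + of_real chi"
proof -
  have "(Complex x y + \<i>) * Complex chi psi - (Complex x y - \<i>) * cnj (Complex chi psi) =
      2 * \<i> * (of_real psi * Complex x y + of_real chi)"
    by (simp add: complex_eq_iff algebra_simps)
  then show ?thesis by simp
qed

section \<open>Changes between the real coordinate systems\<close>

lemma open_half_space: "open half_space"
proof -
  have "half_space = {c. 0 < fst (snd c)}"
    by (auto simp: half_space_def)
  moreover have "open {c :: real \<times> real \<times> real \<times> real. 0 < fst (snd c)}"
    by (intro open_Collect_less continuous_intros)
  ultimately show ?thesis by simp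
qed

lemma change_of_variables_swap:
  "change_of_variables half_space half_space (\<lambda>(x, y, p, q). (x, y, q, p)) (\<lambda>(x, y, chi, psi). (x, y, psi, chi))"
  unfolding change_of_variables_def
proof (intro conjI)
  show "smooth_on half_space (\<lambda>(x, y, p, q). (x, y, q, p))" "smooth_on half_space (\<lambda>(x, y, chi, psi). (x, y, psi, chi))"
    unfolding case_prod_unfold by (intro smooth_on_intros open_half_space)+
qed (auto simp: half_space_def)

text \<open>The system \<open>\<xi> = p x + q\<close>, \<open>\<rho> = p y\<close> is solved for
  \<open>p\<close> and \<open>q\<close>; the quotient is smooth because \<open>y\<close> is positive
  on \<open>half_space\<close>.\<close>

lemma change_of_variables_xi_rho_pq:
  "change_of_variables half_space half_space
    (\<lambda>(x, y, \<xi>, \<rho>). (x, y, \<rho> / y, \<xi> - \<rho> / y * x)) (\<lambda>(x, y, p, q). (x, y, p * x + q, p * y))"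
  unfolding change_of_variables_def
proof (intro conjI)
  show "smooth_on half_space (\<lambda>(x, y, \<xi>, \<rho>). (x, y, \<rho> / y, \<xi> - \<rho> / y * x))"
    unfolding case_prod_unfold by (intro smooth_on_intros open_half_space) (auto simp: half_space_def)
  show "smooth_on half_space (\<lambda>(x, y, p, q). (x, y, p * x + q, p * y))"
    unfolding case_prod_unfold by (intro smooth_on_intros open_half_space)
qed (auto simp: half_space_def)

lemma change_of_variables_xi_rho_chi_psi:
  "change_of_variables half_space half_space
    (\<lambda>(x, y, \<xi>, \<rho>). (x, y, \<xi> - \<rho> / y * x, \<rho> / y)) (\<lambda>(x, y, chi, psi). (x, y, psi * x + chi, psi * y))"
  unfolding change_of_variables_def
proof (intro conjI)
  show "smooth_on half_space (\<lambda>(x, y, \<xi>, \<rho>). (x, y, \<xi> - \<rho> / y * x, \<rho> / y))"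
    unfolding case_prod_unfold by (intro smooth_on_intros open_half_space) (auto simp: half_space_def)
  show "smooth_on half_space (\<lambda>(x, y, chi, psi). (x, y, psi * x + chi, psi * y))"
    unfolding case_prod_unfold by (intro smooth_on_intros open_half_space)
qed (auto simp: half_space_def)

theorem proposition1:
  fixes k \<nu> :: real
  assumes k: "0 < k" "2 * k \<in> \<nat>" and nu: "0 < \<nu>"
  shows
  \<comment> \<open>a)\<close>
  "(is_kahler SJ_disk (omega_disk k \<nu>) \<and>
    group_action GJ0 SJ_disk (\<lambda>g. restrict (disk_act g) SJ_disk) \<and>
    invariant_under (carrier GJ0) disk_act SJ_disk (omega_disk k \<nu>) \<and>
    change_of_variables SJ_disk SJ_disk FC FC_inv \<and>
    (\<forall>p\<in>SJ_disk. \<forall>X. pullback1 FC A_form p X = ed snd p X - fst p * ed (\<lambda>p. cnj (snd p)) p X) \<and>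
    is_kahler_with_metric SJ_disk (metric_disk k \<nu>) (omega_disk k \<nu>) \<and>
    \<not> is_kahler_with_metric SJ_disk (pullback_line FC (metric_disk k \<nu>)) (pullback2 FC (omega_disk k \<nu>)) \<and>
    symplectic_on SJ_disk (pullback2 FC (omega_disk k \<nu>)) \<and>
    group_action GJ0 SJ_disk (\<lambda>g. restrict (disk_eta_act g) SJ_disk) \<and>
    invariant_under (carrier GJ0) disk_eta_act SJ_disk (pullback2 FC (omega_disk k \<nu>)))
   \<and>
   (change_of_variables SJ_half_plane SJ_disk Phi Phi_inv \<and>
    (\<forall>(v, u)\<in>SJ_half_plane. \<forall>X.
       pullback1 Phi A_form (v, u) X = 2 * \<i> / (v + \<i>) * B_form (v, u) X) \<and>
    is_kahler SJ_half_plane (omega_half_plane k \<nu>) \<and>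
    group_action GJR0 SJ_half_plane (\<lambda>g. restrict (half_plane_act g) SJ_half_plane) \<and>
    invariant_under (carrier GJR0) half_plane_act SJ_half_plane (omega_half_plane k \<nu>) \<and>
    change_of_variables SJ_half_plane SJ_half_plane FC1 FC1_inv)
   \<and>
   (\<forall>x y p q :: real. \<forall>X. 0 < y \<longrightarrow>
      (let c = (x, y, p, q);
           v = Complex x y;
           dv = ed (\<lambda>(x, y, p, q). Complex x y) c X;
           du = ed (\<lambda>(x, y, p, q). of_real p * Complex x y + of_real q) c X;
           dp = ed (\<lambda>(x, y, p, q). of_real p) c X;
           dq = ed (\<lambda>(x, y, p, q). of_real q) c X
       in pullback1 vu_of_pq B_form c X = du - of_real p * dv \<and>
          du - of_real p * dv = v * dp + dq \<and>
          v * dp + dq = (of_real x + \<i> * of_real y) * dp + dq))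
   \<and>
   ((\<forall>x y p q chi psi :: real. 0 < y \<longrightarrow>
      (let v = Complex x y; u = of_real p * v + of_real q; \<eta> = Complex chi psi
       in (2 * \<i> * u = (v + \<i>) * \<eta> - (v - \<i>) * cnj \<eta> \<longleftrightarrow> psi = p \<and> chi = q) \<and>
          (2 * \<i> * u = (v + \<i>) * \<eta> - (v - \<i>) * cnj \<eta> \<longrightarrow>
             \<eta> = of_real q + \<i> * of_real p \<and>
             of_real q = 1 / 2 * (\<eta> + cnj \<eta>) \<and>
             of_real p = 1 / (2 * \<i>) * (\<eta> - cnj \<eta>)))) \<and>
    change_of_variables half_space half_space (\<lambda>(x, y, p, q). (x, y, q, p)) (\<lambda>(x, y, chi, psi). (x, y, psi, chi)) \<and>
    (\<forall>x y chi psi :: real. \<forall>X. 0 < y \<longrightarrow>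
      (let c = (x, y, chi, psi);
           dchi = ed (\<lambda>(x, y, chi, psi). of_real chi) c X;
           dpsi = ed (\<lambda>(x, y, chi, psi). of_real psi) c X
       in pullback1 vu_of_chi_psi B_form c X = of_real x * dpsi + dchi + \<i> * of_real y * dpsi)) \<and>
    (\<forall>x y p q \<xi> \<rho> :: real. 0 < y \<longrightarrow>
      (Complex \<xi> \<rho> = of_real p * Complex x y + of_real q \<longleftrightarrow> \<xi> = p * x + q \<and> \<rho> = p * y)) \<and>
    change_of_variables half_space half_space
      (\<lambda>(x, y, \<xi>, \<rho>). (x, y, \<rho> / y, \<xi> - \<rho> / y * x)) (\<lambda>(x, y, p, q). (x, y, p * x + q, p * y)) \<and>
    (\<forall>x y \<xi> \<rho> :: real. \<forall>X. 0 < y \<longrightarrow>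
      (let c = (x, y, \<xi>, \<rho>);
           dv = ed (\<lambda>(x, y, \<xi>, \<rho>). Complex x y) c X;
           du = ed (\<lambda>(x, y, \<xi>, \<rho>). Complex \<xi> \<rho>) c X
       in pullback1 vu_of_xi_rho B_form c X = du - of_real (\<rho> / y) * dv \<and>
          du - of_real (\<rho> / y) * dv =
            ed (\<lambda>(x, y, \<xi>, \<rho>). of_real \<xi> + \<i> * of_real \<rho>) c X
            - of_real (\<rho> / y) * ed (\<lambda>(x, y, \<xi>, \<rho>). of_real x + \<i> * of_real y) c X)) \<and>
    (\<forall>x y \<xi> \<rho> chi psi :: real. 0 < y \<longrightarrow>
      (let v = Complex x y; u = Complex \<xi> \<rho>; \<eta> = Complex chi psi
       in 2 * \<i> * u = (v + \<i>) * \<eta> - (v - \<i>) * cnj \<eta> \<longleftrightarrow> \<xi> = psi * x + chi \<and> \<rho> = psi * y)) \<and>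
    change_of_variables half_space half_space
      (\<lambda>(x, y, \<xi>, \<rho>). (x, y, \<xi> - \<rho> / y * x, \<rho> / y)) (\<lambda>(x, y, chi, psi). (x, y, psi * x + chi, psi * y)))"
  unfolding Let_def
proof (intro conjI allI impI ballI)
  show "is_kahler SJ_disk (omega_disk k \<nu>)"
    using kahler_with_omega_disk[OF k(1) nu] by (auto simp: is_kahler_def)
  show "symplectic_on SJ_disk (pullback2 FC (omega_disk k \<nu>))"
    by (rule is_kahler_imp_symplectic_on[OF open_SJ_disk is_kahler_pullback_FC_omega_disk[OF k(1) nu]])
next
  fix p X
  assume "p \<in> SJ_disk"
  moreover have "ed (\<lambda>p. cnj (snd p)) p X = cnj (snd X)"
    by (rule ed_eqI) (auto intro!: derivative_eq_intros)
  ultimately show "pullback1 FC A_form p X = ed snd p X - fst p * ed (\<lambda>p. cnj (snd p)) p X"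
    by (simp add: pullback_FC_A_form ed_snd)
next
  show "case p of (v, u) \<Rightarrow> \<forall>X. pullback1 Phi A_form (v, u) X = 2 * \<i> / (v + \<i>) * B_form (v, u) X"
    if "p \<in> SJ_half_plane" for p
    using pullback_Phi_A_form[OF that] by (simp add: case_prod_unfold)
next
  fix x y p q chi psi :: real
  assume y: "0 < y"
  \<comment> \<open>For \<open>y > 0\<close> the numbers \<open>1\<close> and
    \<open>x + \<i> y\<close> are linearly independent over the reals.\<close>
  have "of_real p * Complex x y + of_real q = of_real psi * Complex x y + of_real chi \<longleftrightarrow> psi = p \<and> chi = q"
    using y by (auto simp: complex_eq_iff)
  then show iff: "2 * \<i> * (of_real p * Complex x y + of_real q) =
        (Complex x y + \<i>) * Complex chi psi - (Complex x y - \<i>) * cnj (Complex chi psi) \<longleftrightarrow> psi = p \<and> chi = q"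
    by (simp only: FC1_relation_iff[OF y])
  assume "2 * \<i> * (of_real p * Complex x y + of_real q) =
        (Complex x y + \<i>) * Complex chi psi - (Complex x y - \<i>) * cnj (Complex chi psi)"
  then have "psi = p" "chi = q"
    by (simp_all only: iff)
  then show "Complex chi psi = of_real q + \<i> * of_real p"
    "of_real q = 1 / 2 * (Complex chi psi + cnj (Complex chi psi))"
    "of_real p = 1 / (2 * \<i>) * (Complex chi psi - cnj (Complex chi psi))"
    by (simp_all add: complex_eq_iff)
next
  show "Complex \<xi> \<rho> = of_real p * Complex x y + of_real q \<longleftrightarrow> \<xi> = p * x + q \<and> \<rho> = p * y" for x y p q \<xi> \<rho> :: real
    by (auto simp: complex_eq_iff)
  show "2 * \<i> * Complex \<xi> \<rho> = (Complex x y + \<i>) * Complex chi psi - (Complex x y - \<i>) * cnj (Complex chi psi)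
      \<longleftrightarrow> \<xi> = psi * x + chi \<and> \<rho> = psi * y" if "0 < y" for x y \<xi> \<rho> chi psi :: real
    unfolding FC1_relation_iff[OF that] by (auto simp: complex_eq_iff)
  show "pullback1 vu_of_pq B_form (x, y, p, q) X =
      ed (\<lambda>(x, y, p, q). of_real p * Complex x y + of_real q) (x, y, p, q) X
      - of_real p * ed (\<lambda>(x, y, p, q). Complex x y) (x, y, p, q) X" if "0 < y" for x y p q :: real and X
    using that by (rule pullback_vu_of_pq_B_form)
  show "Complex x y * ed (\<lambda>(x, y, p, q). of_real p) (x, y, p, q) X + ed (\<lambda>(x, y, p, q). of_real q) (x, y, p, q) X =
      (of_real x + \<i> * of_real y) * ed (\<lambda>(x, y, p, q). of_real p) (x, y, p, q) X
      + ed (\<lambda>(x, y, p, q). of_real q) (x, y, p, q) X" for x y p q :: real and X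
    by (simp only: Complex_eq)
  show "ed (\<lambda>(x, y, \<xi>, \<rho>). Complex \<xi> \<rho>) (x, y, \<xi>, \<rho>) X
      - of_real (\<rho> / y) * ed (\<lambda>(x, y, \<xi>, \<rho>). Complex x y) (x, y, \<xi>, \<rho>) X =
      ed (\<lambda>(x, y, \<xi>, \<rho>). of_real \<xi> + \<i> * of_real \<rho>) (x, y, \<xi>, \<rho>) X
      - of_real (\<rho> / y) * ed (\<lambda>(x, y, \<xi>, \<rho>). of_real x + \<i> * of_real y) (x, y, \<xi>, \<rho>) X"
    for x y \<xi> \<rho> :: real and X
    by (simp only: Complex_eq)
qed (simp_all only: ed_pv_plus_q pullback_vu_of_chi_psi_B_form pullback_vu_of_xi_rho_B_form
    group_action_disk_act invariant_omega_disk change_of_variables_FC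
    is_kahler_with_metric_disk[OF k(1) nu] not_kahler_with_metric_pullback_FC[OF nu]
    group_action_disk_eta_act invariant_pullback_FC_omega_disk change_of_variables_Phi
    is_kahler_omega_half_plane[OF k(1) nu] group_action_half_plane_act invariant_omega_half_plane
    change_of_variables_FC1 change_of_variables_swap change_of_variables_xi_rho_pq
    change_of_variables_xi_rho_chi_psi not_False_eq_True)

end
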